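(* Every plane ortho-fin multigraph on $n\geq 1$ vertices has at most $5n-2$ edges. Moreover, this bound is best possible: for every $n\geq 1$ there exists a plane ortho-fin multigraph with $n$ vertices and exactly $5n-2$ edges.
   Context: A plane multigraph $G=(V,E)$ is a multigraph (loops and multiple edges allowed) embedded in the plane so that the vertices are distinct points, each edge is a Jordan arc between its endpoints not passing through any other vertex, and any two edges may intersect only at vertices. A plane ortho-fin multigraph is a plane multigraph in which every edge $e\in E$ is a polygonal path $e=(p_0,p_1,\ldots,p_k)$ (with $p_0=p_k$ allowed for loops) whose first and last segments are either parallel or orthogonal, i.e., $p_0p_1\parallel p_{k-1}p_k$ or $p_0p_1\perp p_{k-1}p_k$. *)

theory Defs
  imports "HOL-Analysis.Analysis"
begin

text \<open>
  The plane is the type \<^typ>\<open>complex\<close>, viewed as a two-dimensional Euclidean space.  A vertex is a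
  point, and an edge is identified with the curve drawing it.  A plain set of curves does allow
  loops and multiple edges: parallel edges are different curves with the same endpoints.  Nor can
  one edge be counted several times (e.g. once for each orientation), as two parametrisations of
  the same arc meet outside the finite set of vertices.

  In the library, \<^const>\<open>simple_path\<close> permits just the two endpoints to coincide, so it covers Jordan
  arcs and, for loops, simple closed curves.
\<close>

definition plane_multigraph :: "complex set \<Rightarrow> (real \<Rightarrow> complex) set \<Rightarrow> bool" where
  "plane_multigraph V E \<longleftrightarrow>
     finite V \<and>
     (\<forall>e\<in>E. simple_path e \<and> pathstart e \<in> V \<and> pathfinish e \<in> V \<and>
            path_image e \<inter> V \<subseteq> {pathstart e, pathfinish e}) \<and>
     (\<forall>e\<in>E. \<forall>f\<in>E. e \<noteq> f \<longrightarrow> path_image e \<inter> path_image f \<subseteq> V)"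

text \<open>The first two equations are dummy cases; only lists of at least two points are used below.\<close>

fun polygonal_path :: "complex list \<Rightarrow> real \<Rightarrow> complex" where
  "polygonal_path [] = linepath 0 0"
| "polygonal_path [p] = linepath p p"
| "polygonal_path [p, q] = linepath p q"
| "polygonal_path (p # q # r # ps) = linepath p q +++ polygonal_path (q # r # ps)"

definition parallel :: "complex \<Rightarrow> complex \<Rightarrow> bool" where
  "parallel u v \<longleftrightarrow> collinear {0, u, v}"

text \<open>
  The polygonal path $(p_0, \ldots, p_k)$ is the list of its $k + 1 \geq 2$ points.  On zero vectors
  both alternatives below would be trivially true, but in a plane multigraph all segments have
  positive length: a path with a degenerate segment is constant on an interval, hence not simple.
\<close>

definition ortho_fin :: "complex list \<Rightarrow> bool" where
  "ortho_fin ps \<longleftrightarrow>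
     (let k = length ps - 1; u = ps ! 1 - ps ! 0; v = ps ! k - ps ! (k - 1)
      in parallel u v \<or> orthogonal u v)"

definition plane_ortho_fin_multigraph :: "complex set \<Rightarrow> (real \<Rightarrow> complex) set \<Rightarrow> bool" where
  "plane_ortho_fin_multigraph V E \<longleftrightarrow>
     plane_multigraph V E \<and>
     (\<forall>e\<in>E. \<exists>ps. length ps \<ge> 2 \<and> e = polygonal_path ps \<and> ortho_fin ps)"

end

theory Submission
  imports Defs
begin

text \<open>
  Upper bound.  Since first and last segments are parallel or orthogonal, the corner angles met
  on a walk around a face add up to a positive multiple of \<open>\<pi>/2\<close>, while all corners together have
  at most \<open>2\<pi>n\<close>: there are at most \<open>4n\<close> face walks.  Instead of Euler's formula, a linear
  system is used.  A real cycle \<open>z\<close> on the edges has a winding function, which is constant along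
  every face walk and jumps by \<open>2\<pi>z(e)\<close> across \<open>e\<close>; hence a cycle whose winding function takes the
  same value on all face walks vanishes.  If \<open>|E| + 1\<close> unknowns (the weights \<open>z(e)\<close> and that common
  value) outnumbered the at most \<open>n - 1 + 4n\<close> equations (all vertices but one are balanced, every
  face walk has the common value), there would be a nontrivial solution.

  Lower bound.  Two disjoint loops inside a third one serve for \<open>n = 1\<close>; then repeatedly a vertex with three
  such loops and two edges to the previous vertex is added in the outer face, such that every face
  keeps the angle sum \<open>\<pi>/2\<close>.
\<close>

section \<open>Polygonal paths\<close>

text \<open>The winding function is never evaluated off the drawing. Its values on both sides of a
  segment are recovered on the segment itself: the sum of the angles under which all other segments
  are seen is constant along it and is the mean of the two one-sided values, while its own angle is
  \<pi> on one side and -\<pi> on the other. Limits at the ends of a segment carry this value past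
  the bends, hence along a whole edge, and relate it at a vertex to the directions of the darts.
  Thus faces enter only as orbits of a permutation of darts, and the geometry is confined to one
  jump condition. The value shared by all face walks stays an unknown, so that no outer face has to
  be singled out. As only the zero solution exists, |E| + 1 \<le> (n - 1) + 4n, which is the
  bound.\<close>

lemma polygonal_path_Cons:
  "length ps \<ge> 2 \<Longrightarrow> polygonal_path (p # ps) = linepath p (hd ps) +++ polygonal_path ps"
  by (cases ps rule: polygonal_path.cases) auto

lemma pathstart_polygonal_path: "length ps \<ge> 2 \<Longrightarrow> pathstart (polygonal_path ps) = hd ps"
  by (cases ps rule: polygonal_path.cases) auto

lemma pathfinish_polygonal_path: "length ps \<ge> 2 \<Longrightarrow> pathfinish (polygonal_path ps) = last ps"
  by (induction ps rule: polygonal_path.induct) auto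

lemma path_image_polygonal_path:
  "length ps \<ge> 2 \<Longrightarrow> path_image (polygonal_path ps) =
    (\<Union>i<length ps - 1. closed_segment (ps ! i) (ps ! Suc i))"
proof (induction ps rule: polygonal_path.induct)
  case (4 p q r ps)
  have "path_image (polygonal_path (p # q # r # ps)) =
    closed_segment p q \<union> path_image (polygonal_path (q # r # ps))"
    using pathstart_polygonal_path[of "q # r # ps"] by (simp add: path_image_join)
  also have "\<dots> = closed_segment p q \<union> (\<Union>i<Suc (length ps). closed_segment ((q # r # ps) ! i) ((q # r # ps) ! Suc i))"
    using 4 by (simp del: nth_Cons_Suc)
  finally show ?case
    by (simp add: lessThan_Suc_eq_insert_0[of "Suc (length ps)"] del: polygonal_path.simps)
qed auto

text \<open>In a simple path only the parameters 0 and 1 can share a point. The point of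
  \<open>g2\<close> at parameter \<open>s\<close> has parameter \<open>(s + 1) / 2\<close> in the
  join, which is never 0, so \<open>s = 1\<close>.\<close>

lemma simple_path_join_start_only_finish:
  assumes "simple_path (g1 +++ g2)" "pathfinish g1 = pathstart g2"
    and "pathstart g1 \<in> path_image g2"
  shows "pathstart g1 = pathfinish g2"
proof -
  from assms(3) obtain s where s: "s \<in> {0..1}" "pathstart g1 = g2 s" by (auto simp: path_image_def)
  define t where "t = (s + 1) / 2"
  have t: "t \<in> {0..1}" "t \<noteq> 0" using s by (auto simp: t_def)
  have "(g1 +++ g2) t = g2 s"
    using s(1) assms(2) unfolding t_def
    by (cases "s = 0") (auto simp: joinpaths_def pathfinish_def pathstart_def add_divide_distrib)
  also have "g2 s = (g1 +++ g2) 0" using s by (simp add: joinpaths_def pathstart_def)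
  finally have "(g1 +++ g2) t = (g1 +++ g2) 0" .
  moreover have "loop_free (g1 +++ g2)" using assms(1) by (simp add: simple_path_def)
  ultimately have "t = 0 \<or> t = 1"
    unfolding loop_free_def using t(1) atLeastAtMost_iff[of 0 0 "1::real"] by (metis order_refl zero_le_one)
  then have "s = 1" using t by (auto simp: t_def)
  then show ?thesis using s by (simp add: pathfinish_def)
qed

lemma arc_polygonal_path:
  assumes "arc (polygonal_path ps)" "length ps \<ge> 2"
  shows "distinct ps \<and> (\<forall>j<length ps - 1. \<forall>i<j. closed_segment (ps ! i) (ps ! Suc i) \<inter>
     closed_segment (ps ! j) (ps ! Suc j) \<subseteq> (if j = Suc i then {ps ! j} else {}))"
  using assms
proof (induction ps rule: polygonal_path.induct)
  case (3 p q)
  then show ?case using arc_distinct_ends[of "linepath p q"] by auto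
next
  case (4 p q r ps)
  let ?qs = "q # r # ps"
  have "pathstart (polygonal_path ?qs) = q" by (simp add: pathstart_polygonal_path)
  then have *: "arc (linepath p q)" "arc (polygonal_path ?qs)"
    "closed_segment p q \<inter> path_image (polygonal_path ?qs) \<subseteq> {q}"
    using 4(2) by (simp_all add: arc_join_eq)
  then have IH: "distinct ?qs" and IHd: "\<And>i j. j < length ?qs - 1 \<Longrightarrow> i < j \<Longrightarrow>
     closed_segment (?qs ! i) (?qs ! Suc i) \<inter> closed_segment (?qs ! j) (?qs ! Suc j) \<subseteq> (if j = Suc i then {?qs ! j} else {})"
    using 4(1) by (auto simp del: polygonal_path.simps)
  have pq: "p \<noteq> q" using * by (metis arc_distinct_ends pathfinish_linepath pathstart_linepath)
  have img: "path_image (polygonal_path ?qs) = (\<Union>i<Suc (length ps). closed_segment (?qs ! i) (?qs ! Suc i))"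
    by (simp add: path_image_polygonal_path del: nth_Cons_Suc polygonal_path.simps)
  have "p \<notin> set ?qs"
  proof
    assume "p \<in> set ?qs"
    then obtain i where i: "i < length ?qs" "?qs ! i = p" by (metis in_set_conv_nth)
    have "p \<in> path_image (polygonal_path ?qs)"
    proof (cases "i < Suc (length ps)")
      case True
      then show ?thesis unfolding img using i by (intro UN_I[of i]) auto
    next
      case False
      then have "i = Suc (length ps)" using i by simp
      then show ?thesis unfolding img using i by (intro UN_I[of "length ps"]) auto
    qed
    then show False using * pq by auto
  qed
  then have dist: "distinct (p # ?qs)" using IH by simp
  have first: "closed_segment p q \<inter> closed_segment (?qs ! j) (?qs ! Suc j) \<subseteq> (if j = 0 then {q} else {})"
    if "j < Suc (length ps)" for j
  proof -
    have sub: "closed_segment p q \<inter> closed_segment (?qs ! j) (?qs ! Suc j) \<subseteq> {q}"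
      using * that unfolding img by blast
    show ?thesis
    proof (cases "j = 0")
      case False
      have "q \<notin> closed_segment (?qs ! j) (?qs ! Suc j)"
      proof
        assume q: "q \<in> closed_segment (?qs ! j) (?qs ! Suc j)"
        have "q \<in> closed_segment (?qs ! 0) (?qs ! Suc 0)" by simp
        with q IHd[of j 0] that False have "j = 1 \<and> q = ?qs ! 1" by (auto split: if_splits)
        then show False using IH by simp
      qed
      then show ?thesis using sub by auto
    qed (use sub in simp)
  qed
  have "closed_segment ((p # ?qs) ! i) ((p # ?qs) ! Suc i) \<inter>
     closed_segment ((p # ?qs) ! j) ((p # ?qs) ! Suc j) \<subseteq> (if j = Suc i then {(p # ?qs) ! j} else {})"
    if ij: "j < length (p # ?qs) - 1" "i < j" for i j
  proof (cases i)
    case 0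
    with first[of "j - 1"] ij show ?thesis by (cases j) (auto split: if_splits)
  next
    case (Suc i')
    then obtain j' where "j = Suc j'" using ij by (cases j) auto
    with Suc IHd[of j' i'] ij show ?thesis by (auto split: if_splits)
  qed
  then show ?case using dist by blast
qed auto

definition seg :: "complex list \<Rightarrow> nat \<Rightarrow> complex set" where
  "seg ps i = closed_segment (ps ! i) (ps ! Suc i)"

definition embedded_polygon :: "complex list \<Rightarrow> bool" where
  "embedded_polygon ps \<longleftrightarrow>
     (\<forall>i. Suc i < length ps \<longrightarrow> ps ! i \<noteq> ps ! Suc i) \<and>
     (\<forall>i j. Suc i < length ps \<longrightarrow> Suc j < length ps \<longrightarrow> i \<noteq> j \<longrightarrow>
        seg ps i \<inter> open_segment (ps ! j) (ps ! Suc j) = {}) \<and>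
     (\<forall>i j. 0 < i \<longrightarrow> Suc i < length ps \<longrightarrow> Suc j < length ps \<longrightarrow> ps ! i \<in> seg ps j \<longrightarrow> j = i \<or> Suc j = i) \<and>
     (\<forall>j. Suc j < length ps \<longrightarrow> hd ps \<in> seg ps j \<longrightarrow>
        j = 0 \<or> Suc (Suc j) = length ps \<and> last ps = hd ps) \<and>
     (\<forall>j. Suc j < length ps \<longrightarrow> last ps \<in> seg ps j \<longrightarrow>
        Suc (Suc j) = length ps \<or> j = 0 \<and> last ps = hd ps) \<and>
     (\<forall>i. 0 < i \<longrightarrow> Suc i < length ps \<longrightarrow> ps ! i \<noteq> hd ps \<and> ps ! i \<noteq> last ps)"

text \<open>Splitting off the first segment leaves an arc even if the whole path is a loop. So
  \<open>arc_polygonal_path\<close> settles all incidences among the other segments, and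
  \<open>F2\<close> to \<open>F5\<close> those involving the first one.\<close>

lemma embedded_polygon_simple_path:
  assumes "simple_path (polygonal_path ps)" "length ps \<ge> 2"
  shows "embedded_polygon ps"
  using assms
proof (cases ps rule: polygonal_path.cases)
  case (3 p q)
  have "p \<noteq> q"
  proof
    assume "p = q"
    then have "loop_free (linepath p p)" using assms(1) 3 by (simp add: simple_path_def)
    then have "linepath p p 0 = linepath p p (1/2) \<longrightarrow> (0::real) = 1/2 \<or> (0::real) = 0 \<and> (1/2::real) = 1 \<or> (0::real) = 1 \<and> (1/2::real) = 0"
      unfolding loop_free_def by (elim ballE[of _ _ 0] ballE[of _ _ "1/2"]) auto
    then show False by (simp add: linepath_def)
  qed
  then show ?thesis using 3 by (auto simp: embedded_polygon_def)
next
  case (4 p q r rest)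
  define qs where "qs = q # r # rest"
  define m where "m = length rest"
  have ps: "ps = p # qs" and len: "length qs = m + 2" and qs0: "qs ! 0 = q"
    using 4 by (simp_all add: qs_def m_def)
  have lastqs: "last qs = qs ! Suc m" using len by (simp add: last_conv_nth qs_def m_def)
  have seg0: "seg ps 0 = closed_segment p q" and segS: "seg ps (Suc j) = seg qs j" for j
    by (simp_all add: ps seg_def qs0)
  have start: "pathstart (polygonal_path qs) = q" and finish: "pathfinish (polygonal_path qs) = last qs"
    by (simp_all add: pathstart_polygonal_path pathfinish_polygonal_path qs_def del: polygonal_path.simps)
  have sp: "simple_path (linepath p q +++ polygonal_path qs)"
    using assms(1) 4 by (simp add: qs_def)
  from simple_path_joinE[OF sp] start
  have arcs: "arc (linepath p q)" "arc (polygonal_path qs)"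
    "closed_segment p q \<inter> path_image (polygonal_path qs) \<subseteq> {p, q}" by auto
  have pq: "p \<noteq> q" using arcs(1) arc_distinct_ends[of "linepath p q"] by simp
  have dist: "distinct qs" and disj: "\<And>i j. j \<le> m \<Longrightarrow> i < j \<Longrightarrow>
     seg qs i \<inter> seg qs j \<subseteq> (if j = Suc i then {qs ! j} else {})"
    using arc_polygonal_path[OF arcs(2)] len unfolding seg_def by auto
  have neq: "qs ! i \<noteq> qs ! j" if "i < j" "j \<le> Suc m" for i j
    using dist that len by (simp add: nth_eq_iff_index_eq)
  have img: "path_image (polygonal_path qs) = (\<Union>j\<le>m. seg qs j)"
    using len by (simp add: path_image_polygonal_path seg_def lessThan_Suc_atMost)
  have ends: "qs ! j \<in> seg qs j" "qs ! Suc j \<in> seg qs j" for j by (simp_all add: seg_def)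
  have F2: "j = m \<and> qs ! Suc m = p" if "p \<in> seg qs j" "j \<le> m" for j
  proof -
    have "p \<in> path_image (polygonal_path qs)" using that img by blast
    then have p: "p = qs ! Suc m"
      using simple_path_join_start_only_finish[OF sp] start finish lastqs by simp
    have "j = m"
    proof (rule ccontr)
      assume "j \<noteq> m"
      then have "j < m" using that by simp
      then have "p = qs ! m" using disj[of m j] that ends(2)[of m] p by (auto split: if_splits)
      then show False using neq[of m "Suc m"] p by simp
    qed
    with p show ?thesis by simp
  qed
  have F3: "j = 0" if "q \<in> seg qs j" "j \<le> m" for j
  proof (rule ccontr)
    assume "j \<noteq> 0"
    then have "q = qs ! j" using disj[of j 0] that ends(1)[of 0] qs0 by (auto split: if_splits)
    then show False using neq[of 0 j] \<open>j \<noteq> 0\<close> that qs0 by simp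
  qed
  have F4: "x = p \<or> x = q" if "x \<in> closed_segment p q" "x \<in> seg qs j" "j \<le> m" for x j
    using that arcs(3) unfolding img by blast
  have F5: "qs ! i \<noteq> p" if "i \<le> m" for i
    using F2[of i] ends(1)[of i] neq[of i "Suc m"] that by auto
  show ?thesis
    unfolding embedded_polygon_def
  proof (intro conjI allI impI)
    fix i assume "Suc i < length ps"
    then show "ps ! i \<noteq> ps ! Suc i"
      using pq neq len qs0 by (cases i) (auto simp: ps)
  next
    fix i j assume ij: "Suc i < length ps" "Suc j < length ps" "i \<noteq> j"
    show "seg ps i \<inter> open_segment (ps ! j) (ps ! Suc j) = {}"
    proof (rule ccontr)
      assume "\<not> ?thesis"
      then obtain x where x: "x \<in> seg ps i" "x \<in> open_segment (ps ! j) (ps ! Suc j)" by blast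
      then have x': "x \<in> seg ps j" "x \<noteq> ps ! j" "x \<noteq> ps ! Suc j"
        by (auto simp: seg_def open_segment_def)
      show False
      proof (cases i)
        case 0
        then obtain j' where j: "j = Suc j'" "j' \<le> m" using ij len by (cases j) (auto simp: ps)
        then have "x = p \<or> x = q" using F4[of x j'] x x' 0 seg0 segS by simp
        then show False
        proof
          assume "x = p"
          then show False using F2[of j'] x' j segS by (auto simp: ps)
        next
          assume "x = q"
          then show False using F3[of j'] x' j segS qs0 by (auto simp: ps)
        qed
      next
        case (Suc i')
        then have i': "i' \<le> m" using ij len by (simp add: ps)
        show False
        proof (cases j)
          case 0
          then show False using F4[of x i'] x x' Suc i' seg0 segS qs0 by (auto simp: ps)
        next
          case (Suc j')
          then have "j' \<le> m" using ij len by (simp add: ps)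
          consider "i' < j'" | "j' < i'" using ij \<open>i = Suc i'\<close> Suc by linarith
          then show False
          proof cases
            case 1
            then show False
              using disj[of j' i'] x(1) x' Suc \<open>i = Suc i'\<close> \<open>j' \<le> m\<close> segS by (auto simp: ps split: if_splits)
          next
            case 2
            then show False
              using disj[of i' j'] x(1) x' Suc \<open>i = Suc i'\<close> i' segS by (auto simp: ps split: if_splits)
          qed
        qed
      qed
    qed
  next
    fix i j assume ij: "0 < i" "Suc i < length ps" "Suc j < length ps" "ps ! i \<in> seg ps j"
    then obtain i' where i: "i = Suc i'" "i' \<le> m" using len by (cases i) (auto simp: ps)
    show "j = i \<or> Suc j = i"
    proof (cases j)
      case 0
      then have "qs ! i' = p \<or> qs ! i' = q"
        using F4[of "qs ! i'" i'] ij(4) i ends(1) seg0 by (simp add: ps)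
      then have "i' = 0" using F5[of i'] F3[of i'] i ends(1)[of i'] by auto
      then show ?thesis using 0 i by simp
    next
      case (Suc j')
      then have j: "j' \<le> m" "qs ! i' \<in> seg qs j'" using ij len segS i by (simp_all add: ps)
      consider "i' < j'" | "j' < i'" | "i' = j'" by linarith
      then show ?thesis
      proof cases
        case 1
        then have "qs ! i' = qs ! j'" using disj[of j' i'] j ends(1)[of i'] by (auto split: if_splits)
        then show ?thesis using neq[of i' j'] 1 j by simp
      next
        case 2
        then show ?thesis using disj[of i' j'] j i ends(1)[of i'] Suc by (auto split: if_splits)
      qed (use i Suc in simp)
    qed
  next
    fix j assume j: "Suc j < length ps" "hd ps \<in> seg ps j"
    show "j = 0 \<or> Suc (Suc j) = length ps \<and> last ps = hd ps"
    proof (cases j)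
      case (Suc j')
      then show ?thesis using F2[of j'] j len segS lastqs by (auto simp: ps)
    qed simp
  next
    fix j assume j: "Suc j < length ps" "last ps \<in> seg ps j"
    have lp: "last ps = qs ! Suc m" using lastqs len by (auto simp: ps)
    show "Suc (Suc j) = length ps \<or> j = 0 \<and> last ps = hd ps"
    proof (cases j)
      case 0
      then have "qs ! Suc m = p \<or> qs ! Suc m = q"
        using F4[of "qs ! Suc m" m] j lp ends(2)[of m] seg0 by simp
      then show ?thesis using neq[of 0 "Suc m"] qs0 0 lp by (auto simp: ps)
    next
      case (Suc j')
      have "j' = m"
      proof (rule ccontr)
        assume "j' \<noteq> m"
        then have "j' < m" using j Suc len by (simp add: ps)
        then have "qs ! Suc m = qs ! m"
          using disj[of m j'] j lp Suc segS ends(2)[of m] by (auto split: if_splits)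
        then show False using neq[of m "Suc m"] by simp
      qed
      then show ?thesis using Suc len by (simp add: ps)
    qed
  next
    fix i assume i: "0 < i" "Suc i < length ps"
    then obtain i' where i': "i = Suc i'" "i' \<le> m" using len by (cases i) (auto simp: ps)
    have lp: "last ps = qs ! Suc m" using lastqs len by (auto simp: ps)
    show "ps ! i \<noteq> hd ps" using F5[of i'] i' by (simp add: ps)
    show "ps ! i \<noteq> last ps" unfolding lp using neq[of i' "Suc m"] i' by (simp add: ps)
  qed
qed (use assms in auto)

section \<open>Angle sums of closed chains\<close>

text \<open>A quotient \<open>- r\<close> with \<open>r \<ge> 0\<close> would put \<open>p\<close>
  on the segment, with weight \<open>1 / (1 + r)\<close> at \<open>b\<close>. Off the segment, the
  branch cut of \<open>Ln\<close> and \<open>Arg\<close> is thus avoided.\<close>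

lemma ratio_not_nonpos_Reals:
  fixes p :: complex
  assumes "p \<notin> closed_segment a b"
  shows "(b - p) / (a - p) \<notin> \<real>\<^sub>\<le>\<^sub>0"
proof
  assume "(b - p) / (a - p) \<in> \<real>\<^sub>\<le>\<^sub>0"
  then obtain r where r: "r \<ge> 0" "(b - p) / (a - p) = - of_real r"
    by (auto elim!: nonpos_Reals_cases) (metis minus_minus neg_0_le_iff_le of_real_minus)
  have "a \<noteq> p" using assms by auto
  with r have "b - p = - of_real r * (a - p)" by (simp add: field_simps)
  then have eq: "p * of_real (1 + r) = b + of_real r * a" by (simp add: algebra_simps)
  have "p = (1 - 1 / (1 + r)) *\<^sub>R a + (1 / (1 + r)) *\<^sub>R b"
  proof -
    have ne: "of_real (1 + r) \<noteq> (0::complex)" using r(1) by (subst of_real_eq_0_iff) simp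
    have "1 - 1 / (1 + r) = r / (1 + r)" using r(1) by (simp add: field_simps)
    then have "(1 - 1 / (1 + r)) *\<^sub>R a + (1 / (1 + r)) *\<^sub>R b = (b + of_real r * a) / of_real (1 + r)"
      by (simp only:) (simp add: scaleR_conv_of_real add_divide_distrib)
    also have "\<dots> = p" using ne by (simp only: eq[symmetric]) simp
    finally show ?thesis by simp
  qed
  then have "p \<in> closed_segment a b"
    unfolding closed_segment_def using r(1) by (intro CollectI exI[of _ "1 / (1 + r)"]) auto
  with assms show False by blast
qed

text \<open>The derivative is written as the function \<open>1 / (x - p)\<close> at \<open>a\<close>
  minus the same function at \<open>b\<close>, the form that cancels along a closed chain.\<close>

lemma has_field_derivative_Ln_ratio:
  fixes p :: complex
  assumes "p \<notin> closed_segment a b"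
  shows "((\<lambda>w. Ln ((b - w) / (a - w))) has_field_derivative (1 / (a - p) - 1 / (b - p))) (at p)"
proof -
  have ne: "a - p \<noteq> 0" "b - p \<noteq> 0" using assms by auto
  have "((\<lambda>w. (b - w) / (a - w)) has_field_derivative ((b - p) - (a - p)) / ((a - p) * (a - p))) (at p)"
    using ne by (auto intro!: derivative_eq_intros)
  from DERIV_chain2[OF has_field_derivative_Ln[OF ratio_not_nonpos_Reals[OF assms]] this]
  moreover have "inverse ((b - p) / (a - p)) * (((b - p) - (a - p)) / ((a - p) * (a - p))) = 1 / (a - p) - 1 / (b - p)"
  proof -
    have "inverse (y / x) * ((y - x) / (x * x)) = 1 / x - 1 / y" if "x \<noteq> 0" "y \<noteq> 0" for x y :: complex
      using that by (simp add: field_simps)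
    then show ?thesis using ne by blast
  qed
  ultimately show ?thesis by (simp only:)
qed

text \<open>
  The complex logarithms sum up to a function whose derivative telescopes to zero along the closed
  chain; the segment \<^term>\<open>i0\<close> itself only contributes a real multiple of its direction.
\<close>

lemma arg_sum_constant:
  fixes a b :: "'i \<Rightarrow> complex" and z :: "'i \<Rightarrow> real"
  assumes "finite I" "i0 \<in> I"
    and chain: "\<And>g :: complex \<Rightarrow> complex. (\<Sum>i\<in>I. of_real (z i) * (g (a i) - g (b i))) = 0"
    and disj: "\<And>j. j \<in> I \<Longrightarrow> j \<noteq> i0 \<Longrightarrow> closed_segment (a j) (b j) \<inter> open_segment (a i0) (b i0) = {}"
    and pq: "p \<in> open_segment (a i0) (b i0)" "q \<in> open_segment (a i0) (b i0)"
  shows "(\<Sum>j\<in>I - {i0}. z j * Arg ((b j - p) / (a j - p))) = (\<Sum>j\<in>I - {i0}. z j * Arg ((b j - q) / (a j - q)))"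
proof -
  define u where "u = b i0 - a i0"
  define P where "P w = a i0 + w * u" for w
  define h where "h w = (\<Sum>j\<in>I - {i0}. of_real (z j) * Ln ((b j - P w) / (a j - P w)))" for w
  have P_in: "P (of_real s) \<in> open_segment (a i0) (b i0)" if "s \<in> {0<..<1}" for s
    unfolding in_segment(2) using that pq(1)
    by (intro conjI exI[of _ s]) (auto simp: P_def u_def scaleR_conv_of_real algebra_simps)
  have deriv: "((\<lambda>s. Im (h (of_real s))) has_real_derivative 0) (at s)" if s: "s \<in> {0<..<1}" for s
  proof -
    let ?p = "P (of_real s)"
    have out: "?p \<notin> closed_segment (a j) (b j)" if "j \<in> I - {i0}" for j
      using that disj P_in[OF s] by blast
    have "(h has_field_derivative (\<Sum>j\<in>I - {i0}. of_real (z j) * ((1 / (a j - ?p) - 1 / (b j - ?p)) * u))) (at (of_real s))"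
      unfolding h_def
    proof (intro DERIV_sum DERIV_cmult)
      fix j assume j: "j \<in> I - {i0}"
      have "(P has_field_derivative u) (at (of_real s))"
        unfolding P_def by (auto intro!: derivative_eq_intros)
      from DERIV_chain2[OF has_field_derivative_Ln_ratio[OF out[OF j]] this]
      show "((\<lambda>w. Ln ((b j - P w) / (a j - P w))) has_field_derivative
          ((1 / (a j - ?p) - 1 / (b j - ?p)) * u)) (at (of_real s))" .
    qed
    moreover have "(\<Sum>j\<in>I - {i0}. of_real (z j) * ((1 / (a j - ?p) - 1 / (b j - ?p)) * u)) =
        - of_real (z i0) * ((1 / (a i0 - ?p) - 1 / (b i0 - ?p)) * u)"
    proof -
      have "of_real (z i0) * (1 / (a i0 - ?p) - 1 / (b i0 - ?p)) +
        (\<Sum>j\<in>I - {i0}. of_real (z j) * (1 / (a j - ?p) - 1 / (b j - ?p))) = 0"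
        using chain[of "\<lambda>x. 1 / (x - ?p)"] assms(1,2) by (simp add: sum.remove)
      from minus_unique[OF this] show ?thesis
        by (simp only: mult.assoc[symmetric] sum_distrib_right[symmetric] mult_minus_left)
    qed
    moreover have "Im (- of_real (z i0) * ((1 / (a i0 - ?p) - 1 / (b i0 - ?p)) * u)) = 0"
    proof -
      have ne: "u \<noteq> 0" using pq(1) by (auto simp: u_def)
      have "a i0 - ?p = of_real (- s) * u" "b i0 - ?p = of_real (1 - s) * u"
        by (simp_all add: P_def u_def algebra_simps)
      then have "(1 / (a i0 - ?p) - 1 / (b i0 - ?p)) * u = 1 / of_real (- s) - 1 / of_real (1 - s)"
        using nonzero_divide_mult_cancel_right[OF ne]
        by (simp only: left_diff_distrib times_divide_eq_left mult_1)
      then have "(1 / (a i0 - ?p) - 1 / (b i0 - ?p)) * u = of_real (1 / (- s) - 1 / (1 - s))"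
        by simp
      then have "- of_real (z i0) * ((1 / (a i0 - ?p) - 1 / (b i0 - ?p)) * u) =
        of_real (- z i0 * (1 / (- s) - 1 / (1 - s)))" by simp
      then show ?thesis by (simp only: Im_complex_of_real)
    qed
    ultimately obtain D where "(h has_field_derivative D) (at (of_real s))" "Im D = 0" by metis
    then show ?thesis
      using bounded_linear.has_vector_derivative[OF bounded_linear_Im has_vector_derivative_real_field[of h D s UNIV]]
      by (simp add: has_real_derivative_iff_has_vector_derivative)
  qed
  have const: "Im (h (of_real s)) = Im (h (of_real t))" if "s \<in> {0<..<1}" "t \<in> {0<..<1}" for s t
  proof -
    have "((\<lambda>s. Im (h (of_real s))) has_real_derivative 0) (at x within {0<..<1})" if "x \<in> {0<..<1}" for x
      using deriv[OF that] has_field_derivative_at_within by blast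
    from has_field_derivative_zero_constant[OF _ this]
    obtain c where "\<And>x. x \<in> {0<..<1} \<Longrightarrow> Im (h (of_real x)) = c" by auto
    then show ?thesis using that by metis
  qed
  have val: "\<exists>s\<in>{0<..<1}. (\<Sum>j\<in>I - {i0}. z j * Arg ((b j - x) / (a j - x))) = Im (h (of_real s))"
    if x: "x \<in> open_segment (a i0) (b i0)" for x
  proof -
    obtain s where s: "0 < s" "s < 1" "x = (1 - s) *\<^sub>R a i0 + s *\<^sub>R b i0"
      using x unfolding in_segment(2) by blast
    have xP: "x = P (of_real s)"
      by (simp add: s P_def u_def scaleR_conv_of_real algebra_simps)
    have "z j * Arg ((b j - x) / (a j - x)) = Im (of_real (z j) * Ln ((b j - x) / (a j - x)))"
      if "j \<in> I - {i0}" for j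
    proof -
      have "x \<notin> closed_segment (a j) (b j)" using that disj x by blast
      then have "(b j - x) / (a j - x) \<noteq> 0" using ratio_not_nonpos_Reals by fastforce
      then show ?thesis by (simp add: Arg_eq_Im_Ln)
    qed
    then have "(\<Sum>j\<in>I - {i0}. z j * Arg ((b j - x) / (a j - x))) = Im (h (of_real s))"
      unfolding h_def xP[symmetric] Im_sum by (rule sum.cong[OF refl])
    then show ?thesis using s by auto
  qed
  from val[OF pq(1)] val[OF pq(2)] const show ?thesis by metis
qed

lemma Arg_inverse_not_nonpos_Reals:
  assumes "y \<notin> \<real>\<^sub>\<le>\<^sub>0"
  shows "Arg (inverse y) = - Arg y"
proof -
  have "y \<noteq> 0" using assms by auto
  then show ?thesis using assms by (simp add: Arg_eq_Im_Ln Ln_inverse)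
qed

text \<open>
  The limit of \<^term>\<open>Arg ((b - p) / (a - p))\<close> as \<open>p\<close> tends to \<open>v\<close> from the direction \<open>u\<close>.
  If \<open>v\<close> is one of \<open>a\<close> and \<open>b\<close>, the first summand vanishes, due to \<^term>\<open>x / 0 = 0\<close> and \<^term>\<open>Arg 0 = 0\<close>.
\<close>

definition arg_limit :: "complex \<Rightarrow> complex \<Rightarrow> complex \<Rightarrow> complex \<Rightarrow> real" where
  "arg_limit v u a b = Arg ((b - v) / (a - v)) +
     ((if a = v then Arg (- (b - v) / u) else 0) - (if b = v then Arg (- (a - v) / u) else 0))"

text \<open>Otherwise \<open>b - v\<close> would be a positive multiple of \<open>u\<close>, and
  both segments would leave \<open>v\<close> in the same direction and overlap.\<close>

lemma direction_not_nonpos_Reals: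
  fixes v u b :: complex
  assumes "u \<noteq> 0" "b \<noteq> v" "closed_segment v b \<inter> open_segment v (v + u) = {}"
  shows "- (b - v) / u \<notin> \<real>\<^sub>\<le>\<^sub>0"
proof
  assume "- (b - v) / u \<in> \<real>\<^sub>\<le>\<^sub>0"
  then obtain r where r: "r \<ge> 0" "- (b - v) / u = - of_real r"
    by (auto elim!: nonpos_Reals_cases) (metis minus_minus neg_0_le_iff_le of_real_minus)
  then have b: "b = v + of_real r * u" using assms(1) by (simp add: field_simps)
  with assms(2) r(1) have "r > 0" by (cases "r = 0") auto
  \<comment> \<open>Half the shorter length in units of \<open>u\<close>, so that the point lies on
    both segments.\<close>
  define s where "s = min r 1 / 2"
  have s: "0 < s" "s < 1" "s \<le> r" using \<open>r > 0\<close> by (auto simp: s_def min_def)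
  have "v + of_real s * u \<in> open_segment v (v + u)"
    unfolding in_segment(2) using s assms(1)
    by (intro conjI exI[of _ s]) (auto simp: scaleR_conv_of_real algebra_simps)
  moreover have "v + of_real s * u \<in> closed_segment v b"
    unfolding in_segment(1) using s \<open>r > 0\<close>
    by (intro exI[of _ "s / r"]) (auto simp: b scaleR_conv_of_real algebra_simps)
  ultimately show False using assms(3) by blast
qed

text \<open>If \<open>v\<close> is an end of the segment, the quotient tends to 0 or diverges, which
  says nothing about its argument. But \<open>Arg\<close> ignores the positive factor
  \<open>t\<close>; once it is cleared, \<open>- (b - v) / u + t\<close> converges, and
  \<open>disj\<close> keeps the limit off the branch cut. For \<open>v = b\<close> the same is done
  with an inverse.\<close>

lemma tendsto_arg_limit:
  assumes u: "u \<noteq> 0" and ab: "a \<noteq> b"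
    and seg: "v \<in> closed_segment a b \<Longrightarrow> v = a \<or> v = b"
    and disj: "closed_segment a b \<inter> open_segment v (v + u) = {}"
  shows "((\<lambda>t. Arg ((b - (v + of_real t * u)) / (a - (v + of_real t * u)))) \<longlongrightarrow> arg_limit v u a b) (at_right 0)"
proof -
  have t0: "((\<lambda>t::real. of_real t :: complex) \<longlongrightarrow> 0) (at_right 0)"
    using tendsto_of_real[OF tendsto_ident_at[of 0 "{0<..}"]] by simp
  have pos: "eventually (\<lambda>t::real. t > 0) (at_right 0)"
    by (simp add: eventually_at_right_less)
  consider "v \<notin> closed_segment a b" | "v = a" | "v = b" using seg by blast
  then show ?thesis
  proof cases
    case 1
    then have ne: "a - v \<noteq> 0" "a \<noteq> v" "b \<noteq> v" by auto
    have "((\<lambda>t. (b - (v + of_real t * u)) / (a - (v + of_real t * u))) \<longlongrightarrow> (b - (v + 0 * u)) / (a - (v + 0 * u))) (at_right 0)"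
      by (intro tendsto_intros t0) (use ne in auto)
    from isCont_tendsto_compose[OF continuous_at_Arg this] ratio_not_nonpos_Reals[OF 1] ne
    show ?thesis by (simp add: arg_limit_def)
  next
    case 2
    have notin: "- (b - v) / u \<notin> \<real>\<^sub>\<le>\<^sub>0"
      using direction_not_nonpos_Reals[of u b v] u ab disj 2 by auto
    have "((\<lambda>t. - (b - v) / u + of_real t) \<longlongrightarrow> - (b - v) / u + 0) (at_right 0)"
      by (intro tendsto_intros t0)
    from isCont_tendsto_compose[OF continuous_at_Arg this] notin
    have "((\<lambda>t. Arg (- (b - v) / u + of_real t)) \<longlongrightarrow> Arg (- (b - v) / u)) (at_right 0)" by simp
    moreover have "eventually (\<lambda>t. Arg (- (b - v) / u + of_real t) =
        Arg ((b - (v + of_real t * u)) / (a - (v + of_real t * u)))) (at_right 0)"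
      using pos
    proof eventually_elim
      case (elim t)
      have "- (b - v) / u + of_real t = of_real t * ((b - (v + of_real t * u)) / (a - (v + of_real t * u)))"
        using elim u 2 by (simp add: field_simps)
      then show ?case using elim by (simp only: Arg_times_of_real)
    qed
    ultimately have "((\<lambda>t. Arg ((b - (v + of_real t * u)) / (a - (v + of_real t * u)))) \<longlongrightarrow> Arg (- (b - v) / u)) (at_right 0)"
      by (rule Lim_transform_eventually)
    then show ?thesis using 2 ab by (simp add: arg_limit_def Arg_zero)
  next
    case 3
    have notin: "- (a - v) / u \<notin> \<real>\<^sub>\<le>\<^sub>0"
      using direction_not_nonpos_Reals[of u a v] u ab disj 3 by (auto simp: closed_segment_commute)
    then have ne: "- (a - v) / u \<noteq> 0" by auto
    have "((\<lambda>t. inverse (- (a - v) / u + of_real t)) \<longlongrightarrow> inverse (- (a - v) / u + 0)) (at_right 0)"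
      by (intro tendsto_intros t0) (use ne in auto)
    moreover have "inverse (- (a - v) / u + 0) \<notin> \<real>\<^sub>\<le>\<^sub>0" using notin by (simp only: nonpos_Reals_inverse_iff add_0_right) simp
    ultimately have "((\<lambda>t. Arg (inverse (- (a - v) / u + of_real t))) \<longlongrightarrow> Arg (inverse (- (a - v) / u))) (at_right 0)"
      using isCont_tendsto_compose[OF continuous_at_Arg] by fastforce
    moreover have "eventually (\<lambda>t. Arg (inverse (- (a - v) / u + of_real t)) =
        Arg ((b - (v + of_real t * u)) / (a - (v + of_real t * u)))) (at_right 0)"
      using pos
    proof eventually_elim
      case (elim t)
      have "(b - (v + of_real t * u)) / (a - (v + of_real t * u)) =
          of_real t * inverse (- (a - v) / u + of_real t)"
      proof -
        have inverse_neg_ratio: "x * inverse (- y / u) = - (x * u) / y" for x y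
          by (simp add: divide_inverse)
        have "- (a - v) / u + of_real t = - (a - (v + of_real t * u)) / u"
          using u by (simp add: field_simps)
        then have "of_real t * inverse (- (a - v) / u + of_real t) = - (of_real t * u) / (a - (v + of_real t * u))"
          by (simp only: inverse_neg_ratio)
        then show ?thesis using 3 by simp
      qed
      then show ?case using elim by (simp only: Arg_times_of_real)
    qed
    ultimately have "((\<lambda>t. Arg ((b - (v + of_real t * u)) / (a - (v + of_real t * u)))) \<longlongrightarrow> Arg (inverse (- (a - v) / u))) (at_right 0)"
      by (rule Lim_transform_eventually)
    moreover have "Arg (inverse (- (a - v) / u)) = - Arg (- (a - v) / u)"
      by (rule Arg_inverse_not_nonpos_Reals[OF notin])
    ultimately show ?thesis using 3 ab by (simp add: arg_limit_def Arg_zero)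
  qed
qed

text \<open>The sum is constant on the open segment, hence equal to its limit at either end. There
  it can be compared with the sums belonging to the other segments that end in
  \<open>v\<close>.\<close>

lemma arg_sum_at_endpoint:
  fixes a b :: "'i \<Rightarrow> complex" and z :: "'i \<Rightarrow> real"
  assumes "finite I" "i0 \<in> I"
    and chain: "\<And>g :: complex \<Rightarrow> complex. (\<Sum>i\<in>I. of_real (z i) * (g (a i) - g (b i))) = 0"
    and ne: "\<And>j. j \<in> I \<Longrightarrow> a j \<noteq> b j"
    and disj: "\<And>j. j \<in> I \<Longrightarrow> j \<noteq> i0 \<Longrightarrow> closed_segment (a j) (b j) \<inter> open_segment (a i0) (b i0) = {}"
    and ends: "v = a i0 \<and> v' = b i0 \<or> v = b i0 \<and> v' = a i0"
    and touch: "\<And>j. j \<in> I \<Longrightarrow> v \<in> closed_segment (a j) (b j) \<Longrightarrow> v = a j \<or> v = b j"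
    and p: "p \<in> open_segment (a i0) (b i0)"
  shows "(\<Sum>j\<in>I - {i0}. z j * Arg ((b j - p) / (a j - p))) =
    (\<Sum>j\<in>I - {i0}. z j * arg_limit v (v' - v) (a j) (b j))"
proof -
  define u where "u = v' - v"
  have u: "u \<noteq> 0" using ends ne[OF assms(2)] by (auto simp: u_def)
  have os: "open_segment v (v + u) = open_segment (a i0) (b i0)"
    using ends by (auto simp: u_def open_segment_commute)
  let ?f = "\<lambda>p. \<Sum>j\<in>I - {i0}. z j * Arg ((b j - p) / (a j - p))"
  have "((\<lambda>t. ?f (v + of_real t * u)) \<longlongrightarrow> (\<Sum>j\<in>I - {i0}. z j * arg_limit v u (a j) (b j))) (at_right 0)"
  proof (intro tendsto_intros tendsto_arg_limit u)
    fix j assume j: "j \<in> I - {i0}"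
    then show "closed_segment (a j) (b j) \<inter> open_segment v (v + u) = {}"
      unfolding os using disj by blast
  qed (use ne touch in auto)
  moreover have "eventually (\<lambda>t. ?f (v + of_real t * u) = ?f p) (at_right 0)"
  proof -
    have "eventually (\<lambda>t::real. t \<in> {0<..<1}) (at_right 0)"
      by (rule eventually_at_right_real) simp
    then show ?thesis
    proof eventually_elim
      case (elim t)
      have "v + of_real t * u \<in> open_segment v (v + u)"
        unfolding in_segment(2) using elim u
        by (intro conjI exI[of _ t]) (auto simp: scaleR_conv_of_real algebra_simps)
      then show ?case
        unfolding os by (intro arg_sum_constant) (use assms in auto)
    qed
  qed
  ultimately have "((\<lambda>t::real. ?f p) \<longlongrightarrow> (\<Sum>j\<in>I - {i0}. z j * arg_limit v u (a j) (b j))) (at_right 0)"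
    by (rule Lim_transform_eventually)
  then show ?thesis unfolding u_def by (simp add: tendsto_const_iff)
qed

section \<open>Rotation systems with orthogonal edge ends\<close>

text \<open>Gaussian elimination: one equation with a nonzero coefficient removes itself and one
  unknown. The system is a set of coefficient functions, so coinciding equations count once.\<close>

lemma homogeneous_system_nontrivial_solution:
  fixes R :: "('a \<Rightarrow> real) set"
  assumes "finite R" "finite A" "card R < card A"
  shows "\<exists>x. (\<exists>a\<in>A. x a \<noteq> 0) \<and> (\<forall>r\<in>R. (\<Sum>a\<in>A. r a * x a) = 0)"
  using assms
proof (induction "card A" arbitrary: A R)
  case 0
  then show ?case by simp
next
  case (Suc m)
  show ?case
  proof (cases "\<exists>r\<in>R. \<exists>a\<in>A. r a \<noteq> 0")
    case False
    from Suc.prems obtain a where "a \<in> A" by fastforce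
    with False show ?thesis by (intro exI[of _ "\<lambda>_. 1"]) auto
  next
    case True
    then obtain r0 a0 where r0: "r0 \<in> R" and a0: "a0 \<in> A" and nz: "r0 a0 \<noteq> 0" by blast
    define A' where "A' = A - {a0}"
    define f where "f r = (\<lambda>a. r a - r a0 / r0 a0 * r0 a)" for r :: "'a \<Rightarrow> real"
    define R' where "R' = f ` (R - {r0})"
    have cA: "m = card A'" using Suc.hyps(2) a0 Suc.prems(2) by (simp add: A'_def)
    have "card R' \<le> card (R - {r0})" unfolding R'_def using Suc.prems(1) by (intro card_image_le) auto
    also have "\<dots> < card A'"
    proof -
      have "card R > 0" using r0 Suc.prems(1) card_gt_0_iff by blast
      then show ?thesis using r0 a0 Suc.prems unfolding A'_def by simp
    qed
    finally have "card R' < card A'" .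
    moreover have "finite R'" "finite A'" using Suc.prems by (simp_all add: R'_def A'_def)
    ultimately obtain x where x: "\<exists>a\<in>A'. x a \<noteq> 0" and eqs: "\<forall>r\<in>R'. (\<Sum>a\<in>A'. r a * x a) = 0"
      using Suc.hyps(1)[OF cA] by blast
    define y where "y = x(a0 := - (\<Sum>a\<in>A'. r0 a * x a) / r0 a0)"
    have split: "(\<Sum>a\<in>A. r a * y a) = r a0 * y a0 + (\<Sum>a\<in>A'. r a * x a)" for r
    proof -
      have "(\<Sum>a\<in>A. r a * y a) = r a0 * y a0 + (\<Sum>a\<in>A'. r a * y a)"
        unfolding A'_def using a0 Suc.prems(2) by (simp add: sum.remove)
      also have "(\<Sum>a\<in>A'. r a * y a) = (\<Sum>a\<in>A'. r a * x a)"
        by (intro sum.cong) (auto simp: y_def A'_def)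
      finally show ?thesis .
    qed
    have "(\<Sum>a\<in>A. r a * y a) = 0" if "r \<in> R" for r
    proof (cases "r = r0")
      case True
      then show ?thesis unfolding split using nz by (simp add: y_def)
    next
      case False
      with that have "f r \<in> R'" by (auto simp: R'_def)
      with eqs have "(\<Sum>a\<in>A'. f r a * x a) = 0" by blast
      then have "(\<Sum>a\<in>A'. r a * x a) = r a0 / r0 a0 * (\<Sum>a\<in>A'. r0 a * x a)"
        by (simp add: f_def left_diff_distrib sum_subtractf sum_distrib_left mult.assoc)
      then show ?thesis unfolding split using nz by (simp add: y_def)
    qed
    moreover have "\<exists>a\<in>A. y a \<noteq> 0" using x by (auto simp: y_def A'_def)
    ultimately show ?thesis by blast
  qed
qed

text \<open>The principal value is shifted to get a counterclockwise angle in (0, 2\<pi>]: a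
  direction makes a full turn with itself, as befits the only corner at a vertex with a single dart.
  The unshifted \<open>Arg (- v / u)\<close> is the term that occurs in
  \<open>arg_limit\<close>.\<close>

definition ccw_angle :: "complex \<Rightarrow> complex \<Rightarrow> real" where
  "ccw_angle u v = Arg (- v / u) + pi"

lemma ccw_angle_pos: "0 < ccw_angle u v" and ccw_angle_le: "ccw_angle u v \<le> 2 * pi"
  using mpi_less_Arg[of "- v / u"] Arg_le_pi[of "- v / u"] by (auto simp: ccw_angle_def)

lemma ccw_angle_self: "u \<noteq> 0 \<Longrightarrow> ccw_angle u u = 2 * pi"
  by (simp add: ccw_angle_def Arg_eq_pi)

lemma cis_ccw_angle: "u \<noteq> 0 \<Longrightarrow> v \<noteq> 0 \<Longrightarrow> cis (ccw_angle u v) = sgn v / sgn u"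
proof -
  assume "u \<noteq> 0" "v \<noteq> 0"
  then have "cis (Arg (- v / u)) = sgn (- v / u)" by (intro cis_Arg) auto
  also have "\<dots> = - (sgn v / sgn u)"
    by (simp only: sgn_divide sgn_minus divide_minus_left)
  finally show ?thesis by (simp add: ccw_angle_def cis_mult[symmetric])
qed

lemma cis_eq_imp: "cis x = cis y \<Longrightarrow> \<exists>k::int. x = y + 2 * pi * k"
proof -
  assume "cis x = cis y"
  then have "sin x = sin y \<and> cos x = cos y" by (metis cis.simps)
  then show ?thesis using sin_cos_eq_iff by (auto simp: algebra_simps)
qed

lemma ccw_angle_add:
  assumes "u \<noteq> 0" "v \<noteq> 0" "w \<noteq> 0" 
  shows "\<exists>k::int. ccw_angle v w = ccw_angle u w - ccw_angle u v + 2 * pi * k"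
proof (rule cis_eq_imp)
  have "sgn u \<noteq> 0" "sgn v \<noteq> 0" using assms by (simp_all add: sgn_zero_iff)
  then show "cis (ccw_angle v w) = cis (ccw_angle u w - ccw_angle u v)"
    using assms by (simp add: cis_divide[symmetric] cis_ccw_angle field_simps)
qed

lemma int_mult_2pi_unique:
  fixes k :: int
  assumes "\<bar>2 * pi * k\<bar> < 2 * pi" shows "k = 0"
proof -
  from assms have "\<bar>real_of_int k\<bar> * (2 * pi) < 1 * (2 * pi)" by (simp add: abs_mult mult_ac)
  then have "\<bar>real_of_int k\<bar> < 1" by (simp only: mult_less_cancel_right) auto
  then show ?thesis by linarith
qed

lemma ccw_angle_diff_less:
  assumes "u \<noteq> 0" "v \<noteq> 0" "w \<noteq> 0" "ccw_angle u v < ccw_angle u w"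
  shows "ccw_angle v w = ccw_angle u w - ccw_angle u v"
proof -
  obtain k :: int where k: "ccw_angle v w = ccw_angle u w - ccw_angle u v + 2 * pi * k"
    using ccw_angle_add assms by blast
  have "\<bar>2 * pi * k\<bar> < 2 * pi"
    using k ccw_angle_pos[of v w] ccw_angle_le[of v w] ccw_angle_pos[of u v] ccw_angle_le[of u w] assms(4)
    by linarith
  then show ?thesis using int_mult_2pi_unique k by simp
qed

section \<open>The cyclic order of the directions at a vertex\<close>

locale star =
  fixes S :: "'d set" and u :: "'d \<Rightarrow> complex"
  assumes finite_star: "finite S"
    and nonzero: "d \<in> S \<Longrightarrow> u d \<noteq> 0"
    and distinct_directions:
      "d \<in> S \<Longrightarrow> d' \<in> S \<Longrightarrow> d \<noteq> d' \<Longrightarrow> ccw_angle (u d) (u d') \<noteq> 2 * pi"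
begin

text \<open>For \<open>d\<close> in \<open>S\<close> the minimum also ranges over \<open>d\<close>
  itself, whose angle 2\<pi> is the largest; so \<open>succ d = d\<close> only if \<open>d\<close>
  is alone.\<close>

definition succ :: "'d \<Rightarrow> 'd" where
  "succ d = arg_min_on (\<lambda>d'. ccw_angle (u d) (u d')) S"

definition gap :: "'d \<Rightarrow> real" where
  "gap d = ccw_angle (u d) (u (succ d))"

lemma succ_in: "d \<in> S \<Longrightarrow> succ d \<in> S"
  unfolding succ_def using arg_min_if_finite(1) finite_star by blast

lemma gap_le: "d' \<in> S \<Longrightarrow> gap d \<le> ccw_angle (u d) (u d')"
  unfolding gap_def succ_def using arg_min_least finite_star by (metis empty_iff)

lemma ccw_angle_inj:
  assumes "d \<in> S" "a \<in> S" "b \<in> S" "ccw_angle (u d) (u a) = ccw_angle (u d) (u b)"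
  shows "a = b"
proof (rule ccontr)
  assume "a \<noteq> b"
  obtain k :: int where k: "ccw_angle (u a) (u b) = 2 * pi * k"
    using ccw_angle_add[of "u d" "u a" "u b"] nonzero assms by force
  have "ccw_angle (u a) (u b) < 2 * pi"
    using ccw_angle_le[of "u a" "u b"] distinct_directions[OF assms(2,3) \<open>a \<noteq> b\<close>] by linarith
  then have "k = 0"
    using int_mult_2pi_unique[of k] k ccw_angle_pos[of "u a" "u b"] by linarith
  then show False using k ccw_angle_pos[of "u a" "u b"] by simp
qed

text \<open>Turning the reference direction from \<open>d\<close> to \<open>succ d\<close> lowers
  all angles by the gap; only that of \<open>succ d\<close> itself wraps around from 0 to 2\<pi>.
  This wrap is the source of both \<open>sum_gap\<close> and the jump in
  \<open>left_value_rot\<close>.\<close>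

lemma ccw_angle_succ:
  assumes "d \<in> S" "b \<in> S"
  shows "ccw_angle (u (succ d)) (u b) =
    ccw_angle (u d) (u b) - gap d + (if b = succ d then 2 * pi else 0)"
proof (cases "b = succ d")
  case True
  then show ?thesis using assms nonzero by (simp add: gap_def ccw_angle_self)
next
  case False
  then have "gap d \<noteq> ccw_angle (u d) (u b)"
    unfolding gap_def using ccw_angle_inj succ_in assms by metis
  then have "gap d < ccw_angle (u d) (u b)" using gap_le[OF assms(2), of d] by linarith
  then show ?thesis
    using ccw_angle_diff_less[of "u d" "u (succ d)" "u b"] False assms nonzero succ_in
    by (simp add: gap_def)
qed

text \<open>If \<open>x\<close> and \<open>y\<close> had the same successor \<open>s\<close>, the
  angle from \<open>s\<close> to \<open>y\<close> would be \<open>2 * pi - gap y\<close>, but also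
  \<open>gap x\<close> less than the angle from \<open>x\<close> to \<open>y\<close>, which is below
  2\<pi>. Hence \<open>gap x < gap y\<close>, and symmetrically.\<close>

lemma inj_on_succ: "inj_on succ S"
proof (rule inj_onI, rule ccontr)
  fix a b assume ab: "a \<in> S" "b \<in> S" "succ a = succ b" "a \<noteq> b"
  have less: "gap x < gap y" if "x \<in> S" "y \<in> S" "succ x = succ y" "x \<noteq> y" for x y
  proof -
    have lt: "ccw_angle (u x) (u y) < 2 * pi"
      using ccw_angle_le[of "u x" "u y"] distinct_directions[of x y] that by fastforce
    have ne: "y \<noteq> succ x"
    proof
      assume "y = succ x"
      then have "gap y = 2 * pi" using that nonzero by (simp add: gap_def ccw_angle_self)
      then show False using gap_le[of x y] that distinct_directions[of y x] ccw_angle_le[of "u y" "u x"]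
        by force
    qed
    have "ccw_angle (u (succ y)) (u y) = 2 * pi - gap y + (if y = succ y then 2 * pi else 0)"
      using ccw_angle_succ[of y y] that nonzero ccw_angle_self by auto
    moreover have "ccw_angle (u (succ x)) (u y) = ccw_angle (u x) (u y) - gap x"
      using ccw_angle_succ[of x y] that ne by auto
    ultimately show ?thesis using that lt ne by auto
  qed
  from less[OF ab] less[of b a] ab show False by auto
qed

lemma bij_succ: "bij_betw succ S S"
  using inj_on_succ succ_in finite_star by (simp add: bij_betw_def endo_inj_surj image_subset_iff)

text \<open>\<open>ccw_angle_succ\<close> is summed over all \<open>d\<close> for one fixed
  \<open>b\<close>: \<open>succ\<close> permutes \<open>S\<close>, so the angles cancel, and the
  wrap occurs exactly once.\<close>

lemma sum_gap:
  assumes "S \<noteq> {}"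
  shows "(\<Sum>d\<in>S. gap d) = 2 * pi"
proof -
  obtain b where b: "b \<in> S" using assms by blast
  obtain a where a: "a \<in> S" "succ a = b" using bij_succ b by (metis bij_betw_imp_surj_on imageE)
  have "(\<Sum>d\<in>S. ccw_angle (u d) (u b)) = (\<Sum>d\<in>S. ccw_angle (u (succ d)) (u b))"
    by (rule sum.reindex_bij_betw[OF bij_succ, symmetric])
  also have "\<dots> = (\<Sum>d\<in>S. ccw_angle (u d) (u b) - gap d + (if b = succ d then 2 * pi else 0))"
    using ccw_angle_succ b by (intro sum.cong) auto
  also have "(\<Sum>d\<in>S. ccw_angle (u d) (u b) - gap d + (if b = succ d then 2 * pi else 0)) =
    (\<Sum>d\<in>S. ccw_angle (u d) (u b)) - (\<Sum>d\<in>S. gap d) + (\<Sum>d\<in>S. if b = succ d then 2 * pi else 0)"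
    by (simp add: sum.distrib sum_subtractf)
  also have "(\<Sum>d\<in>S. if b = succ d then 2 * pi else 0) = (\<Sum>d\<in>S. if b = d then 2 * pi else 0)"
    by (rule sum.reindex_bij_betw[OF bij_succ])
  also have "\<dots> = 2 * pi" using b finite_star by simp
  finally show ?thesis by simp
qed

end

text \<open>What is kept of a drawing: the darts \<open>(e, False)\<close> and
  \<open>(e, True)\<close> are the two ends of \<open>e\<close>, and \<open>u\<close> is the
  direction in which each leaves its vertex. In \<open>ortho\<close> both directions point into the
  edge; reversing one of them changes its argument by \<pi>, again a multiple of \<pi>/2.\<close>

locale ortho_rotation_system =
  fixes E :: "'e set" and V :: "'v set" and tail :: "'e \<times> bool \<Rightarrow> 'v" and u :: "'e \<times> bool \<Rightarrow> complex"
  assumes finite_E: "finite E" and finite_V: "finite V"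
    and tail_in: "e \<in> E \<Longrightarrow> tail (e, b) \<in> V"
    and direction_nonzero: "e \<in> E \<Longrightarrow> u (e, b) \<noteq> 0"
    and directions_differ: "d \<in> E \<times> UNIV \<Longrightarrow> d' \<in> E \<times> UNIV \<Longrightarrow> d \<noteq> d' \<Longrightarrow> tail d = tail d' \<Longrightarrow>
      ccw_angle (u d) (u d') \<noteq> 2 * pi"
    and ortho: "e \<in> E \<Longrightarrow> \<exists>k::int. Arg (u (e, True)) = Arg (u (e, False)) + k * (pi / 2)"
begin

definition D :: "('e \<times> bool) set" where "D = E \<times> UNIV"
definition at_vertex :: "'v \<Rightarrow> ('e \<times> bool) set" where "at_vertex v = {d \<in> D. tail d = v}"

lemma finite_D: "finite D" using finite_E by (simp add: D_def)

sublocale star "at_vertex v" u for v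
proof
  show "finite (at_vertex v)" using finite_D by (simp add: at_vertex_def)
  show "u d \<noteq> 0" if "d \<in> at_vertex v" for d
    using that direction_nonzero by (auto simp: at_vertex_def D_def)
  show "ccw_angle (u d) (u d') \<noteq> 2 * pi" if "d \<in> at_vertex v" "d' \<in> at_vertex v" "d \<noteq> d'" for d d'
    by (rule directions_differ) (use that in \<open>simp_all add: at_vertex_def D_def\<close>)
qed

section \<open>Face walks and their corners\<close>

definition flip :: "'e \<times> bool \<Rightarrow> 'e \<times> bool" where "flip d = (fst d, \<not> snd d)"
definition rot :: "'e \<times> bool \<Rightarrow> 'e \<times> bool" where "rot d = succ (tail d) d"
definition corner :: "'e \<times> bool \<Rightarrow> real" where "corner d = gap (tail d) d"
text \<open>The region left of \<open>d\<close> is right of \<open>rot d\<close>, the next dart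
  counterclockwise, and hence left of the opposite dart \<open>flip (rot d)\<close>. The orbits of
  \<open>face\<close> are the face walks.\<close>

definition face :: "'e \<times> bool \<Rightarrow> 'e \<times> bool" where "face d = flip (rot d)"

lemma at_vertex_tail: "d \<in> D \<Longrightarrow> d \<in> at_vertex (tail d)"
  by (simp add: at_vertex_def)

lemma rot_in: "d \<in> D \<Longrightarrow> rot d \<in> D" and tail_rot: "d \<in> D \<Longrightarrow> tail (rot d) = tail d"
  using succ_in[OF at_vertex_tail] by (auto simp: at_vertex_def rot_def)

lemma flip_in: "d \<in> D \<Longrightarrow> flip d \<in> D"
  by (auto simp: D_def flip_def)

lemma flip_flip [simp]: "flip (flip d) = d"
  by (simp add: flip_def)

lemma face_in: "d \<in> D \<Longrightarrow> face d \<in> D"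
  by (simp add: face_def flip_in rot_in)

lemma inj_on_face: "inj_on face D"
proof (rule inj_onI)
  fix a b assume ab: "a \<in> D" "b \<in> D" "face a = face b"
  then have eq: "rot a = rot b" unfolding face_def by (metis flip_flip)
  then have "tail a = tail b" using tail_rot ab by metis
  with eq show "a = b"
    using inj_on_succ[of "tail a"] ab at_vertex_tail[of a] at_vertex_tail[of b]
    unfolding rot_def by (auto dest: inj_onD)
qed

lemma corner_pos: "corner d > 0"
  by (simp add: corner_def gap_def ccw_angle_pos)

lemma sum_corner_le: "(\<Sum>d\<in>D. corner d) \<le> 2 * pi * card V"
proof -
  have "(\<Sum>d\<in>D. corner d) = (\<Sum>v\<in>V. \<Sum>d\<in>at_vertex v. corner d)"
    unfolding at_vertex_def
    by (rule sum.group[symmetric]) (use finite_D finite_V tail_in in \<open>auto simp: D_def\<close>)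
  \<comment> \<open>Only an inequality, since isolated vertices have no corners.\<close>
  also have "\<dots> \<le> (\<Sum>v\<in>V. 2 * pi)"
  proof (rule sum_mono)
    fix v
    have "(\<Sum>d\<in>at_vertex v. corner d) = (\<Sum>d\<in>at_vertex v. gap v d)"
      by (intro sum.cong) (auto simp: corner_def at_vertex_def)
    then show "(\<Sum>d\<in>at_vertex v. corner d) \<le> 2 * pi"
      using sum_gap[of v] by (cases "at_vertex v = {}") auto
  qed
  finally show ?thesis by (simp add: mult.commute)
qed

text \<open>
  The orbits of \<^term>\<open>face\<close>, described by their invariant functions: this makes their invariance
  immediate and avoids iterating \<^term>\<open>face\<close>.
\<close>

definition face_class :: "'e \<times> bool \<Rightarrow> ('e \<times> bool) set" where
  "face_class d = {d' \<in> D. \<forall>f :: 'e \<times> bool \<Rightarrow> real. (\<forall>x\<in>D. f (face x) = f x) \<longrightarrow> f d' = f d}"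

lemma face_class_eq: "d' \<in> face_class d \<Longrightarrow> face_class d' = face_class d"
proof -
  assume "d' \<in> face_class d"
  then have "f d' = f d" if "\<forall>x\<in>D. f (face x) = f x" for f :: "'e \<times> bool \<Rightarrow> real"
    using that unfolding face_class_def by blast
  then have "(\<forall>f :: 'e \<times> bool \<Rightarrow> real. (\<forall>x\<in>D. f (face x) = f x) \<longrightarrow> f x = f d') \<longleftrightarrow>
    (\<forall>f :: 'e \<times> bool \<Rightarrow> real. (\<forall>x\<in>D. f (face x) = f x) \<longrightarrow> f x = f d)" for x
    by metis
  then show ?thesis unfolding face_class_def by presburger
qed

lemma face_class_self: "d \<in> D \<Longrightarrow> d \<in> face_class d"
  by (simp add: face_class_def)

lemma bij_face_class: "bij_betw face (face_class d) (face_class d)"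
proof -
  have sub: "face_class d \<subseteq> D" by (auto simp: face_class_def)
  then have "inj_on face (face_class d)" "finite (face_class d)"
    using inj_on_face inj_on_subset finite_D finite_subset by blast+
  moreover have "face ` face_class d \<subseteq> face_class d"
    by (auto simp: face_class_def face_in)
  ultimately show ?thesis by (simp add: bij_betw_def endo_inj_surj)
qed

text \<open>Turning from \<open>d\<close> to \<open>rot d\<close> changes the argument by the corner
  modulo 2\<pi>, and passing to the other end of the edge changes it by a multiple of
  \<pi>/2.\<close>

lemma corner_cong:
  assumes "d \<in> D"
  shows "\<exists>k::int. corner d = Arg (u (face d)) - Arg (u d) + k * (pi / 2)"
proof -
  have nz: "u d \<noteq> 0" "u (rot d) \<noteq> 0"
    using assms direction_nonzero rot_in[OF assms] by (auto simp: D_def)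
  have "cis (corner d) = cis (Arg (u (rot d)) - Arg (u d))"
    using nz by (simp add: corner_def gap_def rot_def[symmetric] cis_ccw_angle cis_divide[symmetric] cis_Arg)
  then obtain m :: int where m: "corner d = Arg (u (rot d)) - Arg (u d) + 2 * pi * m"
    using cis_eq_imp by blast
  obtain e b where eb: "rot d = (e, b)" "e \<in> E" using rot_in[OF assms] by (auto simp: D_def)
  obtain k :: int where "Arg (u (e, True)) = Arg (u (e, False)) + k * (pi / 2)" using ortho eb by blast
  then have "\<exists>k::int. Arg (u (rot d)) = Arg (u (face d)) + k * (pi / 2)"
    unfolding face_def flip_def eb
    by (cases b) (auto intro: exI[of _ k] exI[of _ "- k"])
  then obtain j :: int where "Arg (u (rot d)) = Arg (u (face d)) + j * (pi / 2)" by blast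
  with m have "corner d = Arg (u (face d)) - Arg (u d) + real_of_int (j + 4 * m) * (pi / 2)"
    by (simp add: algebra_simps)
  then show ?thesis by blast
qed

text \<open>\<open>face\<close> permutes the class, so the arguments cancel and an integer multiple
  of \<pi>/2 remains; it is positive because every corner is.\<close>

lemma sum_corner_face_class:
  assumes "d \<in> D"
  shows "pi / 2 \<le> (\<Sum>x\<in>face_class d. corner x)"
proof -
  let ?C = "face_class d"
  have sub: "?C \<subseteq> D" and fin: "finite ?C"
    using finite_D by (auto simp: face_class_def)
  have "\<forall>x\<in>?C. \<exists>k::int. corner x = Arg (u (face x)) - Arg (u x) + k * (pi / 2)"
    using corner_cong sub by blast
  then obtain k :: "'e \<times> bool \<Rightarrow> int"
    where k: "\<And>x. x \<in> ?C \<Longrightarrow> corner x = Arg (u (face x)) - Arg (u x) + k x * (pi / 2)"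
    by metis
  have "(\<Sum>x\<in>?C. Arg (u (face x))) = (\<Sum>x\<in>?C. Arg (u x))"
    by (rule sum.reindex_bij_betw[OF bij_face_class])
  then have eq: "(\<Sum>x\<in>?C. corner x) = of_int (\<Sum>x\<in>?C. k x) * (pi / 2)"
    by (simp add: k sum.distrib sum_subtractf sum_distrib_right del: times_divide_eq_right)
  have "(\<Sum>x\<in>?C. corner x) > 0"
    using fin face_class_self[OF assms] corner_pos by (intro sum_pos) auto
  then have "0 < real_of_int (\<Sum>x\<in>?C. k x)" unfolding eq by (simp only: zero_less_mult_iff) auto
  then have "1 \<le> real_of_int (\<Sum>x\<in>?C. k x)"
    by (simp only: of_int_0_less_iff of_int_1_le_iff int_one_le_iff_zero_less)
  then have "1 * (pi / 2) \<le> real_of_int (\<Sum>x\<in>?C. k x) * (pi / 2)" by (intro mult_right_mono) auto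
  then show ?thesis using eq by simp
qed

lemma card_face_classes_le: "card (face_class ` D) \<le> 4 * card V"
proof -
  let ?F = "face_class ` D"
  have "real (card ?F) * (pi / 2) = (\<Sum>C\<in>?F. pi / 2)" by simp
  also have "\<dots> \<le> (\<Sum>C\<in>?F. \<Sum>x\<in>C. corner x)"
    using sum_corner_face_class by (intro sum_mono) auto
  also have "\<dots> = (\<Sum>C\<in>?F. \<Sum>x | x \<in> D \<and> face_class x = C. corner x)"
  proof (intro sum.cong refl)
    fix C assume "C \<in> ?F"
    then obtain d where "C = face_class d" "d \<in> D" by blast
    moreover have "face_class d \<subseteq> D" by (auto simp: face_class_def)
    ultimately show "C = {x \<in> D. face_class x = C}"
      using face_class_eq[of _ d] face_class_self by blast
  qed
  also have "\<dots> = (\<Sum>x\<in>D. corner x)"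
    by (rule sum.group) (use finite_D in auto)
  also have "\<dots> \<le> real (4 * card V) * (pi / 2)" using sum_corner_le by simp
  finally have "real (card ?F) \<le> real (4 * card V)" by (simp only: mult_le_cancel_right) auto
  then show ?thesis by (simp only: of_nat_le_iff)
qed

section \<open>Cycles and their one-sided winding values\<close>

definition signed :: "('e \<Rightarrow> real) \<Rightarrow> 'e \<times> bool \<Rightarrow> real" where
  "signed z d = (if snd d then - z (fst d) else z (fst d))"

text \<open>\<open>signed z d\<close> is the flow out of the tail of \<open>d\<close>:
  \<open>z\<close> at the start of an edge, \<open>- z\<close> at its end. So this is Kirchhoff's
  law.\<close>

definition cycle :: "('e \<Rightarrow> real) \<Rightarrow> bool" where
  "cycle z \<longleftrightarrow> (\<forall>v\<in>V. (\<Sum>d\<in>at_vertex v. signed z d) = 0)"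

text \<open>
  For a cycle \<open>z\<close>, the angle swept by \<open>z\<close> as seen from a point is locally constant off the
  drawing.  The following is its limit from the left of the dart \<open>d\<close>, where \<open>\<kappa>\<close> collects the
  contributions of the segments that do not end in the vertex of \<open>d\<close>.
\<close>

definition left_value :: "('v \<Rightarrow> 'e \<Rightarrow> real) \<Rightarrow> ('e \<Rightarrow> real) \<Rightarrow> 'e \<times> bool \<Rightarrow> real" where
  "left_value \<kappa> z d = (\<Sum>e\<in>E. z e * \<kappa> (tail d) e) +
     (\<Sum>d'\<in>at_vertex (tail d). signed z d' * Arg (- u d' / u d))"

lemma sum_D_signed: "(\<Sum>d\<in>D. signed z d * g d) = (\<Sum>e\<in>E. z e * (g (e, False) - g (e, True)))"
proof -
  have "(\<Sum>d\<in>D. signed z d * g d) = (\<Sum>e\<in>E. \<Sum>b\<in>UNIV. signed z (e, b) * g (e, b))"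
    unfolding D_def by (simp add: sum.cartesian_product)
  then show ?thesis by (simp add: UNIV_bool signed_def algebra_simps)
qed

lemma sum_at_vertex_signed:
  "(\<Sum>d\<in>at_vertex v. signed z d * g d) =
   (\<Sum>e\<in>E. z e * ((if tail (e, False) = v then g (e, False) else 0) - (if tail (e, True) = v then g (e, True) else 0)))"
proof -
  have "(\<Sum>d\<in>at_vertex v. signed z d * g d) = (\<Sum>d\<in>D. signed z d * (if tail d = v then g d else 0))"
    unfolding at_vertex_def sum.inter_filter[OF finite_D] by (intro sum.cong) auto
  then show ?thesis by (simp only: sum_D_signed)
qed

lemma left_value_ccw:
  assumes "cycle z" "d \<in> D"
  shows "left_value \<kappa> z d = (\<Sum>e\<in>E. z e * \<kappa> (tail d) e) +
     (\<Sum>d'\<in>at_vertex (tail d). signed z d' * ccw_angle (u d) (u d'))"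
proof -
  have "tail d \<in> V" using assms tail_in by (auto simp: D_def)
  then have "(\<Sum>d'\<in>at_vertex (tail d). signed z d' * pi) = 0"
    using assms by (simp add: cycle_def sum_distrib_right[symmetric])
  then show ?thesis
    by (simp add: left_value_def ccw_angle_def distrib_left sum.distrib)
qed

text \<open>By \<open>ccw_angle_succ\<close> all angles drop by the same corner, which the zero
  outflow at the vertex cancels; only \<open>rot d\<close> gains a full turn.\<close>

lemma left_value_rot:
  assumes "cycle z" "d \<in> D"
  shows "left_value \<kappa> z (rot d) = left_value \<kappa> z d + 2 * pi * signed z (rot d)"
proof -
  let ?S = "at_vertex (tail d)"
  have v: "tail d \<in> V" using assms tail_in by (auto simp: D_def)
  then have zero: "(\<Sum>d'\<in>?S. signed z d') = 0" using assms by (simp add: cycle_def)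
  have rS: "rot d \<in> ?S" using succ_in[OF at_vertex_tail[OF assms(2)]] by (simp add: rot_def)
  have "(\<Sum>d'\<in>?S. signed z d' * ccw_angle (u (rot d)) (u d')) =
    (\<Sum>d'\<in>?S. signed z d' * ccw_angle (u d) (u d') - signed z d' * corner d
      + (if d' = rot d then 2 * pi * signed z (rot d) else 0))"
  proof (intro sum.cong refl)
    fix d' assume "d' \<in> ?S"
    then have "ccw_angle (u (rot d)) (u d') =
      ccw_angle (u d) (u d') - corner d + (if d' = rot d then 2 * pi else 0)"
      using ccw_angle_succ[OF at_vertex_tail[OF assms(2)]] by (simp add: corner_def rot_def)
    then show "signed z d' * ccw_angle (u (rot d)) (u d') =
      signed z d' * ccw_angle (u d) (u d') - signed z d' * corner d
        + (if d' = rot d then 2 * pi * signed z (rot d) else 0)"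
      by (simp only:) (simp add: algebra_simps)
  qed
  also have "\<dots> = (\<Sum>d'\<in>?S. signed z d' * ccw_angle (u d) (u d')) + 2 * pi * signed z (rot d)"
    using zero rS finite_star[of "tail d"]
    by (simp add: sum.distrib sum_subtractf sum_distrib_right[symmetric])
  finally show ?thesis
    using assms by (simp add: left_value_ccw rot_in tail_rot)
qed

theorem card_edges_le:
  fixes \<kappa> :: "'v \<Rightarrow> 'e \<Rightarrow> real"
  assumes jump: "\<And>z e. cycle z \<Longrightarrow> e \<in> E \<Longrightarrow>
      left_value \<kappa> z (e, False) - left_value \<kappa> z (e, True) = 2 * pi * z e"
    and V: "V \<noteq> {}" and E: "E \<noteq> {}"
  shows "card E + 2 \<le> 5 * card V"
proof (rule ccontr)
  assume "\<not> card E + 2 \<le> 5 * card V"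
  then have big: "5 * card V < card E + 2" by simp
  obtain v0 where v0: "v0 \<in> V" using V by blast
  \<comment> \<open>\<open>None\<close> stands for the common value of the face walks, with the
    opposite sign.\<close>
  define A where "A = insert None (Some ` E)"
  have sumA: "(\<Sum>a\<in>A. f a) = f None + (\<Sum>e\<in>E. f (Some e))" for f :: "'e option \<Rightarrow> real"
    unfolding A_def using finite_E by (subst sum.insert) (auto simp: sum.reindex)
  have cardA: "card A = card E + 1"
    unfolding A_def using finite_E by (subst card_insert_disjoint) (auto simp: card_image)
  define vrow :: "'v \<Rightarrow> 'e option \<Rightarrow> real" where
    "vrow v = case_option 0 (\<lambda>e. (if tail (e, False) = v then 1 else 0) - (if tail (e, True) = v then 1 else 0))" for v
  define frow :: "'e \<times> bool \<Rightarrow> 'e option \<Rightarrow> real" where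
    "frow d = case_option 1 (\<lambda>e. \<kappa> (tail d) e + ((if tail (e, False) = tail d then Arg (- u (e, False) / u d) else 0) -
         (if tail (e, True) = tail d then Arg (- u (e, True) / u d) else 0)))" for d
  have vrow: "(\<Sum>a\<in>A. vrow v a * x a) = (\<Sum>d\<in>at_vertex v. signed (\<lambda>e. x (Some e)) d)" for v x
    using sum_at_vertex_signed[of "\<lambda>e. x (Some e)" "\<lambda>_. 1" v] by (simp add: sumA vrow_def mult.commute)
  have frow: "(\<Sum>a\<in>A. frow d a * x a) = left_value \<kappa> (\<lambda>e. x (Some e)) d + x None" for d x
    unfolding left_value_def sum_at_vertex_signed
    by (simp add: sumA frow_def mult.commute distrib_left sum.distrib)
  \<comment> \<open>One equation per class is enough, as the left values of a cycle are invariant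
    under \<open>face\<close>.\<close>
  define rep where "rep C = (SOME d. d \<in> C)" for C :: "('e \<times> bool) set"
  define R where "R = vrow ` (V - {v0}) \<union> (\<lambda>C. frow (rep C)) ` face_class ` D"
  have finR: "finite R" using finite_V finite_D by (simp add: R_def)
  have "card R \<le> card (vrow ` (V - {v0})) + card ((\<lambda>C. frow (rep C)) ` face_class ` D)"
    unfolding R_def by (rule card_Un_le)
  also have "\<dots> \<le> card (V - {v0}) + card (face_class ` D)"
    using finite_V finite_D by (intro add_mono card_image_le) auto
  also have "\<dots> \<le> card V - 1 + 4 * card V"
    using v0 finite_V card_face_classes_le by simp
  also have "\<dots> < card A"
    using big v0 finite_V card_gt_0_iff[of V] V by (simp add: cardA)
  finally have "card R < card A" .
  moreover have "finite A" using finite_E by (simp add: A_def)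
  ultimately obtain x where x: "\<exists>a\<in>A. x a \<noteq> 0"
    and "\<forall>r\<in>R. (\<Sum>a\<in>A. r a * x a) = 0"
    using homogeneous_system_nontrivial_solution[OF finR] by blast
  then have eqs: "(\<Sum>a\<in>A. r a * x a) = 0" if "r \<in> R" for r using that by blast
  define z where "z e = x (Some e)" for e
  have zero: "(\<Sum>d\<in>at_vertex v. signed z d) = 0" if "v \<in> V - {v0}" for v
    using eqs[of "vrow v"] that unfolding vrow z_def R_def by simp
  \<comment> \<open>The equation dropped at \<open>v0\<close> is recovered: every edge contributes
    both \<open>z\<close> and \<open>- z\<close> to the total outflow.\<close>
  have "(\<Sum>v\<in>V. \<Sum>d\<in>at_vertex v. signed z d) = (\<Sum>d\<in>D. signed z d)"
    unfolding at_vertex_def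
    by (rule sum.group) (use finite_D finite_V tail_in in \<open>auto simp: D_def\<close>)
  also have "\<dots> = 0" using sum_D_signed[of z "\<lambda>_. 1"] by simp
  finally have "(\<Sum>d\<in>at_vertex v0. signed z d) = 0"
    using zero v0 finite_V by (simp add: sum.remove)
  with zero have cyc: "cycle z" by (auto simp: cycle_def)
  have jump': "left_value \<kappa> z d - left_value \<kappa> z (flip d) = 2 * pi * signed z d" if "d \<in> D" for d
    using jump[OF cyc, of "fst d"] that by (cases d; cases "snd d") (auto simp: D_def flip_def signed_def)
  \<comment> \<open>Turning to \<open>rot d\<close> adds what crossing its edge takes away
    again.\<close>
  have inv: "left_value \<kappa> z (face d) = left_value \<kappa> z d" if "d \<in> D" for d
    using jump'[OF rot_in[OF that]] left_value_rot[OF cyc that] unfolding face_def by simp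
  have const: "left_value \<kappa> z d = - x None" if "d \<in> D" for d
  proof -
    have "rep (face_class d) \<in> face_class d"
      unfolding rep_def using face_class_self[OF that] by (rule someI)
    then have "left_value \<kappa> z (rep (face_class d)) = left_value \<kappa> z d"
      using inv unfolding face_class_def by blast
    moreover have "frow (rep (face_class d)) \<in> R" using that unfolding R_def by blast
    from eqs[OF this] have "left_value \<kappa> z (rep (face_class d)) + x None = 0"
      unfolding frow z_def[abs_def] .
    ultimately show ?thesis by simp
  qed
  have z0: "z e = 0" if "e \<in> E" for e
    using jump[OF cyc that] const[of "(e, False)"] const[of "(e, True)"] that by (simp add: D_def)
  obtain e where e: "e \<in> E" using E by blast
  have "left_value \<kappa> z (e, False) = 0"
    unfolding left_value_def using z0
    by (auto simp: at_vertex_def D_def signed_def intro!: sum.neutral)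
  with const[of "(e, False)"] e have "x None = 0" by (simp add: D_def)
  with x z0 show False by (auto simp: A_def z_def)
qed

end

section \<open>The upper bound\<close>

lemma Arg_diff_of_fourth_power:
  assumes "u \<noteq> 0" "v \<noteq> 0" "(sgn v / sgn u) ^ 4 = 1"
  shows "\<exists>k::int. Arg v = Arg u + k * (pi / 2)"
proof -
  have "cis (4 * (Arg v - Arg u)) = cis (Arg v - Arg u) ^ 4"
    using Complex.DeMoivre[of "Arg v - Arg u" 4] by simp
  also have "\<dots> = (cis (Arg v) / cis (Arg u)) ^ 4" by (simp only: cis_divide)
  also have "\<dots> = cis 0" using assms by (simp add: cis_Arg)
  finally obtain m :: int where "4 * (Arg v - Arg u) = 0 + 2 * pi * m" using cis_eq_imp by blast
  then have "Arg v = Arg u + m * (pi / 2)" by (simp add: field_simps)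
  then show ?thesis by blast
qed

text \<open>The unit vectors of \<open>u\<close> and \<open>v\<close> differ by a fourth root of
  unity. The sign in \<open>Arg (- v)\<close> is due to the last segment of an edge pointing towards
  its end vertex, while darts point away from theirs.\<close>

lemma Arg_diff_of_ortho:
  assumes "u \<noteq> 0" "v \<noteq> 0" "parallel u v \<or> orthogonal u v"
  shows "\<exists>k::int. Arg (- v) = Arg u + k * (pi / 2)"
proof (rule Arg_diff_of_fourth_power)
  obtain c w where cw: "v = of_real c * w * u" "w = 1 \<or> w = \<i>"
    using assms(3)
  proof
    assume "parallel u v"
    then obtain c where "v = c *\<^sub>R u" using assms(1,2) by (auto simp: parallel_def collinear_lemma)
    then show thesis using that[of c 1] by (simp add: scaleR_conv_of_real)
  next
    assume "orthogonal u v"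
    then have "Re (v / u) = 0"
      by (simp add: orthogonal_def inner_complex_def Re_divide mult.commute)
    then have "v / u = of_real (Im (v / u)) * \<i>" by (simp add: complex_eq_iff)
    then have "v = of_real (Im (v / u)) * \<i> * u" using assms(1) by (simp add: field_simps)
    then show thesis using that by blast
  qed
  then have "c \<noteq> 0" using assms(2) by auto
  have "sgn (- v) = - (of_real (sgn c) * w * sgn u)"
    using cw by (auto simp: sgn_minus sgn_mult sgn_of_real sgn_div_norm[of \<i>])
  then have "sgn (- v) / sgn u = - (of_real (sgn c) * w)"
    using assms(1) by (simp add: sgn_zero_iff)
  then have "(sgn (- v) / sgn u) ^ 4 = of_real (sgn c ^ 4) * w ^ 4" by (simp add: power_mult_distrib)
  moreover have "sgn c ^ 4 = 1" using \<open>c \<noteq> 0\<close> by (auto simp: sgn_real_def)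
  moreover have "w ^ 4 = 1" using cw(2) by (auto simp: power4_eq_xxxx)
  ultimately show "(sgn (- v) / sgn u) ^ 4 = 1" by simp
qed (use assms in auto)

locale ortho_fin_drawing =
  fixes V :: "complex set" and E :: "(real \<Rightarrow> complex) set" and ps :: "(real \<Rightarrow> complex) \<Rightarrow> complex list"
  assumes multigraph: "plane_multigraph V E"
    and finite_edges: "finite E"
    and length_ge: "e \<in> E \<Longrightarrow> length (ps e) \<ge> 2"
    and edge_eq: "e \<in> E \<Longrightarrow> e = polygonal_path (ps e)"
    and ortho_fin: "e \<in> E \<Longrightarrow> ortho_fin (ps e)"
begin

text \<open>Index of the last segment: \<open>ps e\<close> has \<open>k e + 2\<close> points and the
  segments 0 to \<open>k e\<close>.\<close>

definition k :: "(real \<Rightarrow> complex) \<Rightarrow> nat" where "k e = length (ps e) - 2"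
definition I :: "((real \<Rightarrow> complex) \<times> nat) set" where "I = Sigma E (\<lambda>e. {..k e})"
definition a :: "(real \<Rightarrow> complex) \<times> nat \<Rightarrow> complex" where "a j = ps (fst j) ! snd j"
definition b :: "(real \<Rightarrow> complex) \<times> nat \<Rightarrow> complex" where "b j = ps (fst j) ! Suc (snd j)"
definition tail :: "(real \<Rightarrow> complex) \<times> bool \<Rightarrow> complex" where
  "tail d = (if snd d then ps (fst d) ! Suc (k (fst d)) else ps (fst d) ! 0)"
definition dir :: "(real \<Rightarrow> complex) \<times> bool \<Rightarrow> complex" where
  "dir d = (if snd d then ps (fst d) ! k (fst d) - ps (fst d) ! Suc (k (fst d)) else ps (fst d) ! 1 - ps (fst d) ! 0)"

lemma finite_vertices: "finite V" using multigraph by (simp add: plane_multigraph_def)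

lemma finite_I: "finite I" by (simp add: I_def finite_edges)

lemma in_I: "(e, i) \<in> I \<longleftrightarrow> e \<in> E \<and> i \<le> k e" by (simp add: I_def)

lemma length_ps: "e \<in> E \<Longrightarrow> length (ps e) = k e + 2" using length_ge[of e] by (simp add: k_def)

lemma hd_ps: "e \<in> E \<Longrightarrow> hd (ps e) = tail (e, False)"
  using length_ps[of e] by (simp add: tail_def hd_conv_nth flip: length_greater_0_conv)

lemma last_ps: "e \<in> E \<Longrightarrow> last (ps e) = tail (e, True)"
  using length_ps[of e] by (simp add: tail_def last_conv_nth flip: length_greater_0_conv)

lemma path_ends: "e \<in> E \<Longrightarrow> pathstart e = tail (e, False)" "e \<in> E \<Longrightarrow> pathfinish e = tail (e, True)"
  using edge_eq length_ge pathstart_polygonal_path pathfinish_polygonal_path hd_ps last_ps by metis+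

lemma embedded:
  assumes "e \<in> E"
  shows "i \<le> k e \<Longrightarrow> ps e ! i \<noteq> ps e ! Suc i"
    and "i \<le> k e \<Longrightarrow> j \<le> k e \<Longrightarrow> i \<noteq> j \<Longrightarrow> closed_segment (a (e, i)) (b (e, i)) \<inter> open_segment (a (e, j)) (b (e, j)) = {}"
    and "0 < i \<Longrightarrow> i \<le> k e \<Longrightarrow> j \<le> k e \<Longrightarrow> ps e ! i \<in> closed_segment (a (e, j)) (b (e, j)) \<Longrightarrow> j = i \<or> Suc j = i"
    and "j \<le> k e \<Longrightarrow> tail (e, False) \<in> closed_segment (a (e, j)) (b (e, j)) \<Longrightarrow> j = 0 \<or> j = k e \<and> tail (e, True) = tail (e, False)"
    and "j \<le> k e \<Longrightarrow> tail (e, True) \<in> closed_segment (a (e, j)) (b (e, j)) \<Longrightarrow> j = k e \<or> j = 0 \<and> tail (e, True) = tail (e, False)"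
    and "0 < i \<Longrightarrow> i \<le> k e \<Longrightarrow> ps e ! i \<noteq> tail (e, False) \<and> ps e ! i \<noteq> tail (e, True)"
proof -
  have "simple_path e" using multigraph assms by (simp add: plane_multigraph_def)
  then have "embedded_polygon (ps e)"
    using embedded_polygon_simple_path[of "ps e"] edge_eq[OF assms] length_ge[OF assms] by simp
  then have *: "\<And>i. i \<le> k e \<Longrightarrow> ps e ! i \<noteq> ps e ! Suc i"
    "\<And>i j. i \<le> k e \<Longrightarrow> j \<le> k e \<Longrightarrow> i \<noteq> j \<Longrightarrow> seg (ps e) i \<inter> open_segment (ps e ! j) (ps e ! Suc j) = {}"
    "\<And>i j. 0 < i \<Longrightarrow> i \<le> k e \<Longrightarrow> j \<le> k e \<Longrightarrow> ps e ! i \<in> seg (ps e) j \<Longrightarrow> j = i \<or> Suc j = i"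
    "\<And>j. j \<le> k e \<Longrightarrow> tail (e, False) \<in> seg (ps e) j \<Longrightarrow> j = 0 \<or> j = k e \<and> tail (e, True) = tail (e, False)"
    "\<And>j. j \<le> k e \<Longrightarrow> tail (e, True) \<in> seg (ps e) j \<Longrightarrow> j = k e \<or> j = 0 \<and> tail (e, True) = tail (e, False)"
    "\<And>i. 0 < i \<Longrightarrow> i \<le> k e \<Longrightarrow> ps e ! i \<noteq> tail (e, False) \<and> ps e ! i \<noteq> tail (e, True)"
    unfolding embedded_polygon_def hd_ps[OF assms] last_ps[OF assms] length_ps[OF assms] by simp_all
  show "i \<le> k e \<Longrightarrow> ps e ! i \<noteq> ps e ! Suc i" by (rule *)
  show "i \<le> k e \<Longrightarrow> j \<le> k e \<Longrightarrow> i \<noteq> j \<Longrightarrow> closed_segment (a (e, i)) (b (e, i)) \<inter> open_segment (a (e, j)) (b (e, j)) = {}"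
    using *(2)[of i j] by (simp add: a_def b_def seg_def)
  show "0 < i \<Longrightarrow> i \<le> k e \<Longrightarrow> j \<le> k e \<Longrightarrow> ps e ! i \<in> closed_segment (a (e, j)) (b (e, j)) \<Longrightarrow> j = i \<or> Suc j = i"
    using *(3)[of i j] by (simp add: a_def b_def seg_def)
  show "j \<le> k e \<Longrightarrow> tail (e, False) \<in> closed_segment (a (e, j)) (b (e, j)) \<Longrightarrow> j = 0 \<or> j = k e \<and> tail (e, True) = tail (e, False)"
    using *(4)[of j] by (simp add: a_def b_def seg_def)
  show "j \<le> k e \<Longrightarrow> tail (e, True) \<in> closed_segment (a (e, j)) (b (e, j)) \<Longrightarrow> j = k e \<or> j = 0 \<and> tail (e, True) = tail (e, False)"
    using *(5)[of j] by (simp add: a_def b_def seg_def)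
  show "0 < i \<Longrightarrow> i \<le> k e \<Longrightarrow> ps e ! i \<noteq> tail (e, False) \<and> ps e ! i \<noteq> tail (e, True)"
    by (rule *)
qed

lemma a_neq_b: "j \<in> I \<Longrightarrow> a j \<noteq> b j"
  using embedded(1)[of "fst j" "snd j"] by (cases j) (auto simp: in_I a_def b_def)

lemma path_image_edge:
  assumes "e \<in> E" shows "path_image e = (\<Union>i\<le>k e. closed_segment (a (e, i)) (b (e, i)))"
proof -
  have "path_image e = path_image (polygonal_path (ps e))" using edge_eq[OF assms] by simp
  then show ?thesis
    using length_ps[OF assms] by (simp add: path_image_polygonal_path a_def b_def lessThan_Suc_atMost)
qed

lemma segment_subset: "(e, i) \<in> I \<Longrightarrow> closed_segment (a (e, i)) (b (e, i)) \<subseteq> path_image e"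
  using path_image_edge by (auto simp: in_I)

lemma tail_in_V: "e \<in> E \<Longrightarrow> tail (e, s) \<in> V"
  using multigraph path_ends[of e] by (cases s) (auto simp: plane_multigraph_def)

lemma edge_meets_V: "e \<in> E \<Longrightarrow> x \<in> path_image e \<Longrightarrow> x \<in> V \<Longrightarrow> x = tail (e, False) \<or> x = tail (e, True)"
  using multigraph path_ends[of e] unfolding plane_multigraph_def by blast

lemma edges_meet: "e \<in> E \<Longrightarrow> f \<in> E \<Longrightarrow> e \<noteq> f \<Longrightarrow> path_image e \<inter> path_image f \<subseteq> V"
  using multigraph unfolding plane_multigraph_def by blast

lemma open_segment_not_V:
  assumes "(e, i) \<in> I" "x \<in> open_segment (a (e, i)) (b (e, i))"
  shows "x \<notin> V"
proof
  assume "x \<in> V"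
  have x: "x \<in> closed_segment (a (e, i)) (b (e, i))" "x \<noteq> a (e, i)" "x \<noteq> b (e, i)"
    using assms(2) by (auto simp: open_segment_def)
  have e: "e \<in> E" "i \<le> k e" using assms(1) by (auto simp: in_I)
  have "x = tail (e, False) \<or> x = tail (e, True)"
    using edge_meets_V[OF e(1)] x(1) segment_subset[OF assms(1)] \<open>x \<in> V\<close> by blast
  then show False
    using embedded(4)[OF e(1), of i] embedded(5)[OF e(1), of i] x e by (auto simp: a_def b_def tail_def)
qed

lemma segments_disjoint:
  assumes "i \<in> I" "j \<in> I" "i \<noteq> j"
  shows "closed_segment (a i) (b i) \<inter> open_segment (a j) (b j) = {}"
proof -
  obtain e i' f j' where ij: "i = (e, i')" "j = (f, j')" by (metis surj_pair)
  show ?thesis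
  proof (cases "e = f")
    case True
    then show ?thesis using embedded(2)[of e i' j'] assms ij by (auto simp: in_I)
  next
    case False
    then have "path_image e \<inter> path_image f \<subseteq> V" using edges_meet assms ij by (auto simp: in_I)
    then have "closed_segment (a i) (b i) \<inter> closed_segment (a j) (b j) \<subseteq> V"
      using segment_subset assms ij by blast
    moreover have "open_segment (a j) (b j) \<subseteq> closed_segment (a j) (b j)"
      by (rule segment_open_subset_closed)
    ultimately show ?thesis using open_segment_not_V assms(2) ij(2) by blast
  qed
qed

lemma bend_not_V:
  assumes "e \<in> E" "0 < i" "i \<le> k e"
  shows "ps e ! i \<notin> V"
proof
  assume "ps e ! i \<in> V"
  moreover have "ps e ! i \<in> path_image e"
    using segment_subset[of e i] assms by (auto simp: in_I a_def)
  ultimately show False using edge_meets_V[OF assms(1)] embedded(6)[OF assms] by blast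
qed

lemma bend_in_segment:
  assumes "e \<in> E" "0 < i" "i \<le> k e" "j \<in> I" "ps e ! i \<in> closed_segment (a j) (b j)"
  shows "j = (e, i) \<or> j = (e, i - 1)"
proof -
  obtain f j' where j: "j = (f, j')" by (cases j)
  have "f = e"
  proof (rule ccontr)
    assume "f \<noteq> e"
    have "ps e ! i \<in> path_image e" using segment_subset[of e i] assms by (auto simp: in_I a_def)
    moreover have "ps e ! i \<in> path_image f" using segment_subset assms(4,5) j by blast
    ultimately show False
      using edges_meet[of e f] \<open>f \<noteq> e\<close> assms j bend_not_V[OF assms(1-3)] by (auto simp: in_I)
  qed
  then show ?thesis using embedded(3)[OF assms(1-3), of j'] assms j by (auto simp: in_I)
qed

lemma vertex_touch: "v \<in> V \<Longrightarrow> j \<in> I \<Longrightarrow> v \<in> closed_segment (a j) (b j) \<Longrightarrow> v = a j \<or> v = b j"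
  using open_segment_not_V[of "fst j" "snd j" v] by (auto simp: open_segment_def)

definition segment_of :: "(real \<Rightarrow> complex) \<times> bool \<Rightarrow> (real \<Rightarrow> complex) \<times> nat" where
  "segment_of d = (fst d, if snd d then k (fst d) else 0)"

lemma segment_of:
  assumes "d \<in> E \<times> UNIV"
  shows "segment_of d \<in> I"
    and "closed_segment (a (segment_of d)) (b (segment_of d)) = closed_segment (tail d) (tail d + dir d)"
    and "open_segment (a (segment_of d)) (b (segment_of d)) = open_segment (tail d) (tail d + dir d)"
  using assms by (auto simp: segment_of_def in_I a_def b_def tail_def dir_def
      closed_segment_commute open_segment_commute)

lemma dir_nonzero: "e \<in> E \<Longrightarrow> dir (e, s) \<noteq> 0"
  using embedded(1)[of e 0] embedded(1)[of e "k e"] by (auto simp: dir_def)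

sublocale ortho_rotation_system E V tail dir
proof
  show "finite E" "finite V" by (rule finite_edges finite_vertices)+
  show "tail (e, s) \<in> V" if "e \<in> E" for e s using that by (rule tail_in_V)
  show "dir (e, s) \<noteq> 0" if "e \<in> E" for e s using that by (rule dir_nonzero)
  show "\<exists>m::int. Arg (dir (e, True)) = Arg (dir (e, False)) + m * (pi / 2)" if e: "e \<in> E" for e
  proof -
    have "parallel (dir (e, False)) (- dir (e, True)) \<or> orthogonal (dir (e, False)) (- dir (e, True))"
      using ortho_fin[OF e] length_ps[OF e] by (simp add: ortho_fin_def Let_def dir_def)
    from Arg_diff_of_ortho[OF _ _ this] show ?thesis using dir_nonzero[OF e] by simp
  qed
  fix d d' assume d: "d \<in> E \<times> UNIV" "d' \<in> E \<times> UNIV" "d \<noteq> d'" "tail d = tail d'"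
  have "segment_of d \<noteq> segment_of d'"
  proof
    assume eq: "segment_of d = segment_of d'"
    then have "fst d = fst d'" by (simp add: segment_of_def)
    then have "snd d \<noteq> snd d'" using d(3) by (simp add: prod_eq_iff)
    \<comment> \<open>Different darts on the same segment are the two ends of a single-segment edge,
      which would be degenerate if both were at one vertex.\<close>
    then have "k (fst d) = 0" using eq \<open>fst d = fst d'\<close> by (auto simp: segment_of_def split: if_splits)
    then show False
      using embedded(1)[of "fst d" 0] d \<open>fst d = fst d'\<close> \<open>snd d \<noteq> snd d'\<close> by (auto simp: tail_def split: if_splits)
  qed
  then have disj: "closed_segment (tail d) (tail d + dir d') \<inter> open_segment (tail d) (tail d + dir d) = {}"
    using segments_disjoint[of "segment_of d'" "segment_of d"] d segment_of by metis
  have nz: "dir d \<noteq> 0" "dir d' \<noteq> 0" using d dir_nonzero by auto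
  then have "- dir d' / dir d \<notin> \<real>\<^sub>\<le>\<^sub>0"
    using direction_not_nonpos_Reals[OF _ _ disj] by simp
  then have "Arg (- dir d' / dir d) \<noteq> pi"
    by (auto simp: Arg_eq_pi complex_nonpos_Reals_iff)
  then show "ccw_angle (dir d) (dir d') \<noteq> 2 * pi" by (simp add: ccw_angle_def)
qed

text \<open>The angle swept by \<open>e\<close> as seen from \<open>v\<close>. A segment ending in
  \<open>v\<close> contributes \<open>Arg 0 = 0\<close>, either by its numerator or by
  \<open>x / 0 = 0\<close>.\<close>

definition \<kappa> :: "complex \<Rightarrow> (real \<Rightarrow> complex) \<Rightarrow> real" where
  "\<kappa> v e = (\<Sum>i\<le>k e. Arg ((b (e, i) - v) / (a (e, i) - v)))"

definition T :: "complex \<Rightarrow> complex \<Rightarrow> (real \<Rightarrow> complex) \<times> nat \<Rightarrow> real" where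
  "T v u j = (if a j = v then Arg (- (b j - v) / u) else 0) - (if b j = v then Arg (- (a j - v) / u) else 0)"

text \<open>
  The mean of the left and the right limit at the midpoint of segment \<open>i\<close>: there, the omitted
  summand of \<open>i\<close> itself jumps from \<open>\<pi>\<close> to \<open>-\<pi>\<close>.
\<close>

definition off_value :: "((real \<Rightarrow> complex) \<Rightarrow> real) \<Rightarrow> (real \<Rightarrow> complex) \<times> nat \<Rightarrow> real" where
  "off_value z i = (\<Sum>j\<in>I - {i}. z (fst j) *
     Arg ((b j - midpoint (a i) (b i)) / (a j - midpoint (a i) (b i))))"

lemma sum_I: "(\<Sum>j\<in>I. f j) = (\<Sum>e\<in>E. \<Sum>i\<le>k e. f (e, i))"
  unfolding I_def using finite_edges by (simp add: sum.Sigma)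

text \<open>Along each edge the differences telescope to its two ends; collected at the vertices,
  they cancel by Kirchhoff's law. This is the hypothesis \<open>chain\<close> of the angle
  sums.\<close>

lemma cycle_chain:
  fixes g :: "complex \<Rightarrow> complex"
  assumes "cycle z"
  shows "(\<Sum>j\<in>I. of_real (z (fst j)) * (g (a j) - g (b j))) = 0"
proof -
  have "(\<Sum>i\<le>k e. g (a (e, i)) - g (b (e, i))) = g (tail (e, False)) - g (tail (e, True))" for e
    unfolding a_def b_def tail_def fst_conv snd_conv by (subst sum_telescope) simp
  then have "(\<Sum>j\<in>I. of_real (z (fst j)) * (g (a j) - g (b j))) =
    (\<Sum>e\<in>E. of_real (z e) * (g (tail (e, False)) - g (tail (e, True))))"
    by (simp only: sum_I fst_conv sum_distrib_left[symmetric])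
  also have "\<dots> = (\<Sum>e\<in>E. \<Sum>s\<in>UNIV. of_real (signed z (e, s)) * g (tail (e, s)))"
    by (intro sum.cong refl) (simp add: UNIV_bool signed_def algebra_simps)
  also have "\<dots> = (\<Sum>d\<in>D. of_real (signed z d) * g (tail d))"
    unfolding D_def by (simp add: sum.cartesian_product)
  also have "\<dots> = (\<Sum>v\<in>V. \<Sum>d\<in>at_vertex v. of_real (signed z d) * g (tail d))"
    unfolding at_vertex_def
    by (rule sum.group[symmetric]) (use finite_D finite_V tail_in in \<open>auto simp: D_def\<close>)
  also have "\<dots> = (\<Sum>v\<in>V. of_real (\<Sum>d\<in>at_vertex v. signed z d) * g v)"
    unfolding of_real_sum sum_distrib_right by (intro sum.cong refl) (simp add: at_vertex_def)
  also have "\<dots> = 0" using assms by (simp add: cycle_def)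
  finally show ?thesis .
qed

lemma off_value_at_endpoint:
  assumes "cycle z" "i \<in> I"
    and ends: "v = a i \<and> v' = b i \<or> v = b i \<and> v' = a i"
    and touch: "\<And>j. j \<in> I \<Longrightarrow> v \<in> closed_segment (a j) (b j) \<Longrightarrow> v = a j \<or> v = b j"
  shows "off_value z i = (\<Sum>e\<in>E. z e * \<kappa> v e) + (\<Sum>j\<in>I - {i}. z (fst j) * T v (v' - v) j)"
proof -
  have "midpoint (a i) (b i) \<in> open_segment (a i) (b i)"
    using a_neq_b[OF assms(2)] by simp
  then have "off_value z i = (\<Sum>j\<in>I - {i}. z (fst j) * arg_limit v (v' - v) (a j) (b j))"
    unfolding off_value_def using assms finite_I cycle_chain a_neq_b segments_disjoint
    by (intro arg_sum_at_endpoint) auto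
  also have "\<dots> = (\<Sum>j\<in>I - {i}. z (fst j) * Arg ((b j - v) / (a j - v))) +
      (\<Sum>j\<in>I - {i}. z (fst j) * T v (v' - v) j)"
    by (simp only: arg_limit_def T_def distrib_left sum.distrib)
  \<comment> \<open>Seen from its own endpoint, segment \<open>i\<close> has angle 0 by convention,
    so it may be included.\<close>
  also have "(\<Sum>j\<in>I - {i}. z (fst j) * Arg ((b j - v) / (a j - v))) = (\<Sum>j\<in>I. z (fst j) * Arg ((b j - v) / (a j - v)))"
    using ends by (simp add: sum.remove[OF finite_I assms(2)]) (auto simp: Arg_zero)
  also have "\<dots> = (\<Sum>e\<in>E. z e * \<kappa> v e)"
    by (simp only: sum_I fst_conv sum_distrib_left[symmetric] \<kappa>_def)
  finally show ?thesis .
qed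

text \<open>No other segment touches the common bend. So both values consist of the \<kappa> sum at
  the bend and one correction, due to the neighbouring segment; the two corrections agree, being
  arguments of mutually inverse quotients that enter \<open>T\<close> with opposite signs.\<close>

lemma off_value_Suc:
  assumes "cycle z" "(e, Suc i) \<in> I"
  shows "off_value z (e, i) = off_value z (e, Suc i)"
proof -
  have e: "e \<in> E" "Suc i \<le> k e" and I: "(e, i) \<in> I" using assms(2) by (auto simp: in_I)
  define v x y where "v = ps e ! Suc i" and "x = ps e ! i" and "y = ps e ! Suc (Suc i)"
  have ab: "a (e, i) = x" "b (e, i) = v" "a (e, Suc i) = v" "b (e, Suc i) = y"
    by (simp_all add: a_def b_def v_def x_def y_def)
  have ne: "x \<noteq> v" "v \<noteq> y" using a_neq_b[OF I] a_neq_b[OF assms(2)] ab by auto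
  have only: "j = (e, Suc i) \<or> j = (e, i)" if "j \<in> I" "v \<in> closed_segment (a j) (b j)" for j
    using bend_in_segment[OF e(1) _ e(2) that(1)] that(2) by (auto simp: v_def)
  have touch: "v = a j \<or> v = b j" if "j \<in> I" "v \<in> closed_segment (a j) (b j)" for j
    using only[OF that] ab by auto
  have T0: "T v u j = 0" if "j \<in> I" "j \<noteq> (e, Suc i)" "j \<noteq> (e, i)" for u j
    using only[OF that(1)] that by (auto simp: T_def)
  have "(\<Sum>j\<in>I - {(e, i)}. z (fst j) * T v u j) = (\<Sum>j\<in>{(e, Suc i)}. z (fst j) * T v u j)" for u
    using finite_I assms(2) T0 by (intro sum.mono_neutral_right) auto
  then have 1: "off_value z (e, i) = (\<Sum>e\<in>E. z e * \<kappa> v e) + z e * Arg (- (y - v) / (x - v))"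
    using off_value_at_endpoint[OF assms(1) I _ touch, of x] ab ne by (simp add: T_def)
  have "(\<Sum>j\<in>I - {(e, Suc i)}. z (fst j) * T v u j) = (\<Sum>j\<in>{(e, i)}. z (fst j) * T v u j)" for u
    using finite_I I T0 by (intro sum.mono_neutral_right) auto
  then have 2: "off_value z (e, Suc i) = (\<Sum>e\<in>E. z e * \<kappa> v e) - z e * Arg (- (x - v) / (y - v))"
    using off_value_at_endpoint[OF assms(1,2) _ touch, of y] ab ne by (simp add: T_def)
  have "closed_segment v x \<inter> open_segment v (v + (y - v)) = {}"
    using segments_disjoint[OF I assms(2)] ab by (simp add: closed_segment_commute)
  then have "- (x - v) / (y - v) \<notin> \<real>\<^sub>\<le>\<^sub>0"
    using direction_not_nonpos_Reals[of "y - v" x v] ne by auto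
  from Arg_inverse_not_nonpos_Reals[OF this]
  have "Arg (- (y - v) / (x - v)) = - Arg (- (x - v) / (y - v))"
    by (metis inverse_divide minus_divide_divide minus_minus)
  with 1 2 show ?thesis by simp
qed

lemma off_value_edge: "cycle z \<Longrightarrow> (e, i) \<in> I \<Longrightarrow> off_value z (e, i) = off_value z (e, 0)"
proof (induction i)
  case (Suc i)
  then have "(e, i) \<in> I" by (auto simp: in_I)
  then show ?case using Suc off_value_Suc[of z e i] by simp
qed simp

text \<open>Bends are not vertices, so at \<open>v\<close> an edge has terms only from its first and
  its last segment, that is, from its two darts.\<close>

lemma sum_T_vertex:
  assumes "v \<in> V"
  shows "(\<Sum>j\<in>I. z (fst j) * T v u j) = (\<Sum>d\<in>at_vertex v. signed z d * Arg (- dir d / u))"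
proof -
  have "(\<Sum>i\<le>k e. T v u (e, i)) = (if tail (e, False) = v then Arg (- dir (e, False) / u) else 0) -
      (if tail (e, True) = v then Arg (- dir (e, True) / u) else 0)" if e: "e \<in> E" for e
  proof -
    have "(\<Sum>i\<le>k e. if a (e, i) = v then Arg (- (b (e, i) - v) / u) else 0) =
        (\<Sum>i\<in>{0}. if a (e, i) = v then Arg (- (b (e, i) - v) / u) else 0)"
      using bend_not_V[OF e] assms by (intro sum.mono_neutral_right) (auto simp: a_def)
    moreover have "(\<Sum>i\<le>k e. if b (e, i) = v then Arg (- (a (e, i) - v) / u) else 0) =
        (\<Sum>i\<in>{k e}. if b (e, i) = v then Arg (- (a (e, i) - v) / u) else 0)"
    proof (intro sum.mono_neutral_right ballI)
      fix i assume "i \<in> {..k e} - {k e}"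
      then show "(if b (e, i) = v then Arg (- (a (e, i) - v) / u) else 0) = 0"
        using bend_not_V[OF e, of "Suc i"] assms by (auto simp: b_def)
    qed auto
    ultimately show ?thesis
      unfolding T_def sum_subtractf by (simp add: a_def b_def tail_def dir_def)
  qed
  then show ?thesis
    by (simp only: sum_I fst_conv sum_distrib_left[symmetric] sum_at_vertex_signed cong: sum.cong)
qed

text \<open>\<open>left_value\<close> includes the segment of \<open>d\<close> itself, which
  \<open>off_value\<close> omits. Its term is the argument \<pi> of -1, half of the jump, with the
  sign of the dart; the two darts of an edge have opposite signs.\<close>

lemma left_value_eq:
  assumes "cycle z" "d \<in> E \<times> UNIV"
  shows "left_value \<kappa> z d = off_value z (segment_of d) + pi * signed z d"
proof -
  let ?i = "segment_of d"
  have v: "tail d \<in> V" using assms(2) tail_in_V by auto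
  have i: "?i \<in> I" using segment_of(1)[OF assms(2)] .
  define v' where "v' = tail d + dir d"
  have ends: "tail d = a ?i \<and> v' = b ?i \<or> tail d = b ?i \<and> v' = a ?i"
    by (auto simp: v'_def segment_of_def a_def b_def tail_def dir_def)
  have dirnz: "dir d \<noteq> 0" using assms(2) dir_nonzero by auto
  then have Arg1: "Arg (- dir d / dir d) = pi" by (simp add: Arg_eq_pi)
  have own: "z (fst ?i) * T (tail d) (dir d) ?i = pi * signed z d"
    using Arg1 a_neq_b[OF i]
    by (cases "snd d") (auto simp: T_def signed_def segment_of_def a_def b_def tail_def dir_def)
  have "off_value z ?i = (\<Sum>e\<in>E. z e * \<kappa> (tail d) e) + (\<Sum>j\<in>I - {?i}. z (fst j) * T (tail d) (v' - tail d) j)"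
    using off_value_at_endpoint[OF assms(1) i ends vertex_touch[OF v]] .
  also have "v' - tail d = dir d" by (simp add: v'_def)
  finally have "off_value z ?i + pi * signed z d =
      (\<Sum>e\<in>E. z e * \<kappa> (tail d) e) + (\<Sum>j\<in>I. z (fst j) * T (tail d) (dir d) j)"
    using own by (simp add: sum.remove[OF finite_I i])
  then show ?thesis by (simp add: sum_T_vertex[OF v] left_value_def)
qed

lemma card_edges_bound:
  assumes "E \<noteq> {}"
  shows "card E + 2 \<le> 5 * card V"
proof (rule card_edges_le)
  show "V \<noteq> {}" using assms tail_in_V by blast
  fix z e assume z: "cycle z" and e: "e \<in> E"
  have "off_value z (segment_of (e, True)) = off_value z (segment_of (e, False))"
    using off_value_edge[OF z, of e "k e"] e by (simp add: segment_of_def in_I)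
  then show "left_value \<kappa> z (e, False) - left_value \<kappa> z (e, True) = 2 * pi * z e"
    using left_value_eq[OF z] e by (simp add: signed_def)
qed (rule assms)

end

section \<open>Arbitrary edge sets\<close>

lemma plane_ortho_fin_multigraph_subset:
  "plane_ortho_fin_multigraph V E \<Longrightarrow> F \<subseteq> E \<Longrightarrow> plane_ortho_fin_multigraph V F"
  unfolding plane_ortho_fin_multigraph_def plane_multigraph_def by (meson subsetD)

lemma plane_ortho_fin_multigraph_card_le:
  assumes "plane_ortho_fin_multigraph V F" "finite F" "F \<noteq> {}"
  shows "card F + 2 \<le> 5 * card V"
proof -
  from assms(1) have "\<forall>e\<in>F. \<exists>ps. length ps \<ge> 2 \<and> e = polygonal_path ps \<and> ortho_fin ps"
    by (simp add: plane_ortho_fin_multigraph_def)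
  then obtain ps where "\<And>e. e \<in> F \<Longrightarrow> length (ps e) \<ge> 2 \<and> e = polygonal_path (ps e) \<and> ortho_fin (ps e)"
    by metis
  then interpret ortho_fin_drawing V F ps
    using assms by unfold_locales (auto simp: plane_ortho_fin_multigraph_def)
  show ?thesis using card_edges_bound assms(3) .
qed

text \<open>Any subset of the edges again gives a plane ortho-fin multigraph. An infinite or too
  large \<open>E\<close> would have one with exactly \<open>5 * card V - 1\<close> edges, one too
  many.\<close>

lemma plane_ortho_fin_multigraph_finite_card:
  assumes G: "plane_ortho_fin_multigraph V E" and n: "card V \<ge> 1"
  shows "finite E \<and> card E \<le> 5 * card V - 2"
proof (rule ccontr)
  assume neg: "\<not> ?thesis"
  obtain F where F: "F \<subseteq> E" "finite F" "card F = 5 * card V - 1"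
  proof (cases "finite E")
    case True
    with neg have "5 * card V - 1 \<le> card E" by linarith
    then show ?thesis using that obtain_subset_with_card_n[of "5 * card V - 1" E] by metis
  next
    case False
    then show ?thesis using that infinite_arbitrarily_large[of E "5 * card V - 1"] by metis
  qed
  then have "F \<noteq> {}" using n by auto
  from plane_ortho_fin_multigraph_card_le[OF plane_ortho_fin_multigraph_subset[OF G F(1)] F(2) this] F(3) n
  show False by linarith
qed

section \<open>Extremal multigraphs\<close>

lemma path_image_polygonal_path_Cons:
  "length ps \<ge> 2 \<Longrightarrow> path_image (polygonal_path (p # ps)) = closed_segment p (hd ps) \<union> path_image (polygonal_path ps)"
  by (simp add: polygonal_path_Cons path_image_join pathstart_polygonal_path)

text \<open>Twice the signed area of the triangle \<open>p\<close>, \<open>q\<close>,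
  \<open>r\<close>.\<close>

definition cross :: "complex \<Rightarrow> complex \<Rightarrow> complex \<Rightarrow> real" where
  "cross p q r = (Re q - Re p) * (Im r - Im p) - (Im q - Im p) * (Re r - Re p)"

text \<open>
  A sufficient criterion for two segments to meet only inside \<open>X\<close>: the line through one of them
  avoids the other one, or meets it in an endpoint belonging to \<open>X\<close>.
\<close>

definition meet_in :: "complex set \<Rightarrow> complex \<Rightarrow> complex \<Rightarrow> complex \<Rightarrow> complex \<Rightarrow> bool" where
  "meet_in X p q r s \<longleftrightarrow>
     cross p q r * cross p q s > 0 \<or> cross r s p * cross r s q > 0 \<or>
     r \<in> X \<and> cross p q r = 0 \<and> cross p q s \<noteq> 0 \<or> s \<in> X \<and> cross p q s = 0 \<and> cross p q r \<noteq> 0"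

fun meet_list_in :: "complex set \<Rightarrow> complex \<Rightarrow> complex \<Rightarrow> complex list \<Rightarrow> bool" where
  "meet_list_in X p q (r # s # ps) \<longleftrightarrow> meet_in X p q r s \<and> meet_list_in X p q (s # ps)"
| "meet_list_in X p q _ \<longleftrightarrow> True"

fun lists_meet_in :: "complex set \<Rightarrow> complex list \<Rightarrow> complex list \<Rightarrow> bool" where
  "lists_meet_in X (p # q # ps) qs \<longleftrightarrow> meet_list_in X p q qs \<and> lists_meet_in X (q # ps) qs"
| "lists_meet_in X _ qs \<longleftrightarrow> True"

lemma cross_affine: "cross p q ((1 - t) *\<^sub>R r + t *\<^sub>R s) = (1 - t) * cross p q r + t * cross p q s"
  by (simp add: cross_def algebra_simps)

lemma cross_segment: "x \<in> closed_segment p q \<Longrightarrow> cross p q x = 0"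
  by (auto simp: in_segment cross_affine) (simp_all add: cross_def algebra_simps)

lemma cross_no_zero:
  assumes "x \<in> closed_segment r s" "cross p q r * cross p q s > 0" shows "cross p q x \<noteq> 0"
proof -
  obtain t where t: "0 \<le> t" "t \<le> 1" "x = (1 - t) *\<^sub>R r + t *\<^sub>R s" using assms(1) by (auto simp: in_segment)
  have pos: "0 < (1 - t) * x + t * y" if "x > 0" "y > 0" for x y
    using t that by (cases "t = 0") (auto intro: add_nonneg_pos)
  have "cross p q r > 0 \<and> cross p q s > 0 \<or> cross p q r < 0 \<and> cross p q s < 0"
    using assms(2) by (simp add: zero_less_mult_iff)
  then show ?thesis
    using pos[of "cross p q r" "cross p q s"] pos[of "- cross p q r" "- cross p q s"]
    by (auto simp: t cross_affine)
qed

lemma cross_zero_endpoint: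
  assumes "x \<in> closed_segment r s" "cross p q x = 0" "cross p q r = 0" "cross p q s \<noteq> 0"
  shows "x = r"
proof -
  obtain t where t: "x = (1 - t) *\<^sub>R r + t *\<^sub>R s" using assms(1) by (auto simp: in_segment)
  then have "t = 0" using assms(2-4) by (simp add: cross_affine)
  then show ?thesis using t by simp
qed

lemma meet_in:
  assumes "meet_in X p q r s" shows "closed_segment p q \<inter> closed_segment r s \<subseteq> X"
proof
  fix x assume x: "x \<in> closed_segment p q \<inter> closed_segment r s"
  then have 0: "cross p q x = 0" "cross r s x = 0" by (simp_all add: cross_segment)
  have "\<not> cross p q r * cross p q s > 0" "\<not> cross r s p * cross r s q > 0"
    using cross_no_zero[of x r s p q] cross_no_zero[of x p q r s] x 0 by auto
  then show "x \<in> X"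
    using assms cross_zero_endpoint[of x r s p q] cross_zero_endpoint[of x s r p q] x 0
    by (auto simp: meet_in_def closed_segment_commute)
qed

lemma meet_list_in:
  "meet_list_in X p q ps \<Longrightarrow> length ps \<ge> 2 \<Longrightarrow> closed_segment p q \<inter> path_image (polygonal_path ps) \<subseteq> X"
proof (induction X p q ps rule: meet_list_in.induct)
  case (1 X p q r s ps)
  show ?case
  proof (cases "ps = []")
    case True
    then show ?thesis using 1(2) meet_in by simp
  next
    case False
    then have "length (s # ps) \<ge> 2" by (cases ps) auto
    then show ?thesis using 1 meet_in[of X p q r s] path_image_polygonal_path_Cons[of "s # ps" r] by auto
  qed
qed auto

lemma lists_meet_in:
  "lists_meet_in X ps qs \<Longrightarrow> length ps \<ge> 2 \<Longrightarrow> length qs \<ge> 2 \<Longrightarrow>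
    path_image (polygonal_path ps) \<inter> path_image (polygonal_path qs) \<subseteq> X"
proof (induction X ps qs rule: lists_meet_in.induct)
  case (1 X p q ps qs)
  show ?case
  proof (cases "ps = []")
    case True
    then show ?thesis using 1 meet_list_in by simp
  next
    case False
    then have "length (q # ps) \<ge> 2" by (cases ps) auto
    then show ?thesis
      using 1 meet_list_in[of X p q qs] path_image_polygonal_path_Cons[of "q # ps" p] by auto
  qed
qed auto

fun arc_criterion :: "complex list \<Rightarrow> bool" where
  "arc_criterion (p # q # ps) \<longleftrightarrow> p \<noteq> q \<and> meet_list_in {q} p q (q # ps) \<and> arc_criterion (q # ps)"
| "arc_criterion _ \<longleftrightarrow> True"

lemma arc_polygonal_pathI:
  "arc_criterion ps \<Longrightarrow> length ps \<ge> 2 \<Longrightarrow> arc (polygonal_path ps)"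
proof (induction ps rule: polygonal_path.induct)
  case (3 p q)
  then show ?case by (simp add: arc_linepath)
next
  case (4 p q r ps)
  have "closed_segment p q \<inter> path_image (polygonal_path (q # r # ps)) \<subseteq> {q}"
    using 4 meet_list_in[of "{q}" p q "q # r # ps"] by (simp del: polygonal_path.simps)
  moreover have "p \<noteq> q" "arc (polygonal_path (q # r # ps))"
    using 4 by (simp_all del: polygonal_path.simps)
  ultimately show ?case
    by (simp add: arc_join_eq arc_linepath pathstart_polygonal_path)
qed auto

lemma loop_polygonal_pathI:
  assumes "p \<noteq> q" "meet_list_in {p, q} p q (q # r # ps)" "arc_criterion (q # r # ps)" "last (r # ps) = p"
  shows "simple_path (polygonal_path (p # q # r # ps))"
proof -
  have "closed_segment p q \<inter> path_image (polygonal_path (q # r # ps)) \<subseteq> {p, q}"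
    using assms meet_list_in[of "{p, q}" p q "q # r # ps"] by (simp del: polygonal_path.simps)
  moreover have "arc (polygonal_path (q # r # ps))"
    using assms(3) by (intro arc_polygonal_pathI) auto
  ultimately show ?thesis
    using assms(1,4) pathstart_polygonal_path[of "q # r # ps"] pathfinish_polygonal_path[of "q # r # ps"]
    by (simp add: simple_path_join_loop arc_linepath del: last.simps) (auto intro!: simple_path_join_loop simp: arc_linepath)
qed

text \<open>
  The extremal multigraphs are built from the inside out.  A multigraph inside the arrowhead that
  leaves the first quadrant at its vertex \<open>0\<close> free is surrounded by \<open>loop1\<close>, based at a new
  vertex and bounding the same shape ten times as large.  Between the two lie the small loops and
  the edges from \<open>0\<close> to the new vertex: \<open>edge1\<close> is straight and \<open>edge2\<close> goes round the old arrowhead.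
\<close>

definition arrowhead :: "complex set" where
  "arrowhead = {z. Re z - 1 \<le> 2 * Im z \<and> Im z - 1 \<le> 2 * Re z \<and> (Re z \<le> 0 \<or> Im z \<le> 0)}"

abbreviation "apex \<equiv> Complex 3 3"

text \<open>\<open>arrowhead\<close> is the quadrilateral with corners 0, 1, -1 - i and i, whose
  reflex corner 0 faces the first quadrant. The enlarged copy has this corner at
  \<open>apex\<close>.\<close>

definition big_arrowhead :: "complex set" where
  "big_arrowhead = {z. (z - apex) / 10 \<in> arrowhead}"

definition edge1 :: "complex list" where "edge1 = [0, apex]"
text \<open>Both end segments have direction (2, 1), so \<open>edge1\<close> and
  \<open>edge2\<close> form the same angle at 0 and at \<open>apex\<close>. The face around the old
  arrowhead loses this angle of its \<pi>/2 at 0 and gets it back at \<open>apex\<close>.\<close>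

definition edge2 :: "complex list" where "edge2 = [0, Complex 2 1, Complex 0 (-3), Complex (-3) 0, apex]"
text \<open>Its points are \<open>apex + 10 * c\<close> for the corners \<open>c\<close> of
  \<open>arrowhead\<close>. Each of the three loops bounds a right angle at \<open>apex\<close>,
  \<open>loop1\<close> on its outer and the others on their inner side, which leaves one more right
  angle for the region between them.\<close>

definition loop1 :: "complex list" where "loop1 = [apex, Complex 13 3, Complex (-7) (-7), Complex 3 13, apex]"
definition loop2 :: "complex list" where "loop2 = [apex, Complex 2 6, Complex 0 2, apex]"
definition loop3 :: "complex list" where "loop3 = [apex, Complex 2 0, Complex 6 2, apex]"

lemmas gadget_defs = edge1_def edge2_def loop1_def loop2_def loop3_def

lemma simple_gadget:
  "simple_path (polygonal_path edge1)" "simple_path (polygonal_path edge2)"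
  "simple_path (polygonal_path loop1)" "simple_path (polygonal_path loop2)" "simple_path (polygonal_path loop3)"
proof -
  show "simple_path (polygonal_path edge1)" "simple_path (polygonal_path edge2)"
    unfolding edge1_def edge2_def
    by (intro arc_imp_simple_path arc_polygonal_pathI; simp add: meet_in_def cross_def complex_eq_iff)+
  show "simple_path (polygonal_path loop1)" "simple_path (polygonal_path loop2)" "simple_path (polygonal_path loop3)"
    unfolding loop1_def loop2_def loop3_def
    by (rule loop_polygonal_pathI; simp add: meet_in_def cross_def complex_eq_iff)+
qed

lemma gadget_lists_meet:
  "lists_meet_in {0, apex} edge1 edge2" "lists_meet_in {apex} edge1 loop1"
  "lists_meet_in {apex} edge1 loop2" "lists_meet_in {apex} edge1 loop3"
  "lists_meet_in {apex} edge2 loop1" "lists_meet_in {apex} edge2 loop2" "lists_meet_in {apex} edge2 loop3"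
  "lists_meet_in {apex} loop1 loop2" "lists_meet_in {apex} loop1 loop3" "lists_meet_in {apex} loop2 loop3"
  by (simp_all add: gadget_defs meet_in_def cross_def complex_eq_iff)

lemma ortho_fin_gadget:
  "ortho_fin edge1" "ortho_fin edge2" "ortho_fin loop1" "ortho_fin loop2" "ortho_fin loop3"
proof -
  have "Complex 6 3 = 3 *\<^sub>R Complex 2 1" by (simp add: complex_eq_iff)
  then show "ortho_fin edge1" "ortho_fin edge2" "ortho_fin loop1" "ortho_fin loop2" "ortho_fin loop3"
    by (auto simp: gadget_defs ortho_fin_def Let_def parallel_def orthogonal_def inner_complex_def
        collinear_lemma complex_eq_iff)
qed

section \<open>Position of the gadget relative to the two arrowheads\<close>

lemma in_segment_Complex:
  "x \<in> closed_segment p q \<longleftrightarrow>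
   (\<exists>t. 0 \<le> t \<and> t \<le> 1 \<and> Re x = Re p + t * (Re q - Re p) \<and> Im x = Im p + t * (Im q - Im p))"
  by (auto simp: in_segment complex_eq_iff algebra_simps)

text \<open>For numerical ends the conditions of \<open>arrowhead\<close> are linear in the
  parameter \<open>t\<close>, so \<open>linarith\<close> can refute them.\<close>

lemma segment_off_arrowhead:
  assumes "\<And>t. 0 \<le> t \<Longrightarrow> t \<le> 1 \<Longrightarrow> Re p + t * (Re q - Re p) - 1 \<le> 2 * (Im p + t * (Im q - Im p)) \<Longrightarrow>
     Im p + t * (Im q - Im p) - 1 \<le> 2 * (Re p + t * (Re q - Re p)) \<Longrightarrow>
     Re p + t * (Re q - Re p) \<le> 0 \<or> Im p + t * (Im q - Im p) \<le> 0 \<Longrightarrow> False"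
  shows "closed_segment p q \<inter> arrowhead \<subseteq> X"
proof
  fix x assume x: "x \<in> closed_segment p q \<inter> arrowhead"
  then have "x \<in> closed_segment p q" by simp
  then obtain t where t: "0 \<le> t \<and> t \<le> 1 \<and> Re x = Re p + t * (Re q - Re p) \<and> Im x = Im p + t * (Im q - Im p)"
    unfolding in_segment_Complex ..
  have False
    by (rule assms[of t]; use t x in \<open>simp add: arrowhead_def\<close>)
  then show "x \<in> X" ..
qed

lemma segment_from_0:
  assumes "Re q > 0" "Im q > 0"
  shows "closed_segment 0 q \<inter> arrowhead \<subseteq> {0}"
proof
  fix x assume x: "x \<in> closed_segment 0 q \<inter> arrowhead"
  then obtain t where t: "0 \<le> t" "x = t *\<^sub>R q" by (auto simp: in_segment)
  then have "t = 0" using x assms by (cases "t = 0") (auto simp: arrowhead_def mult_le_0_iff)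
  then show "x \<in> {0}" using t by simp
qed

lemma Un_Int_subset: "A \<inter> C \<subseteq> X \<Longrightarrow> B \<inter> C \<subseteq> X \<Longrightarrow> (A \<union> B) \<inter> C \<subseteq> X"
  by auto

lemma edges_off_arrowhead:
  "path_image (polygonal_path edge1) \<inter> arrowhead \<subseteq> {0}" "path_image (polygonal_path edge2) \<inter> arrowhead \<subseteq> {0}"
proof -
  show "path_image (polygonal_path edge1) \<inter> arrowhead \<subseteq> {0}"
    using segment_from_0[of apex] by (simp add: edge1_def)
  have "closed_segment 0 (Complex 2 1) \<inter> arrowhead \<subseteq> {0}" by (rule segment_from_0) auto
  moreover have "closed_segment (Complex 2 1) (Complex 0 (-3)) \<inter> arrowhead \<subseteq> {0}"
    by (rule segment_off_arrowhead; simp; linarith)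
  moreover have "closed_segment (Complex 0 (-3)) (Complex (-3) 0) \<inter> arrowhead \<subseteq> {0}"
    by (rule segment_off_arrowhead; simp; linarith)
  moreover have "closed_segment (Complex (-3) 0) apex \<inter> arrowhead \<subseteq> {0}"
    by (rule segment_off_arrowhead; simp; linarith)
  ultimately show "path_image (polygonal_path edge2) \<inter> arrowhead \<subseteq> {0}"
    unfolding edge2_def
    by (simp add: path_image_polygonal_path_Cons del: polygonal_path.simps(4)) blast
qed

lemma loops_off_arrowhead:
  "path_image (polygonal_path loop1) \<inter> arrowhead \<subseteq> {}" "path_image (polygonal_path loop2) \<inter> arrowhead \<subseteq> {}"
  "path_image (polygonal_path loop3) \<inter> arrowhead \<subseteq> {}"
  unfolding loop1_def loop2_def loop3_def
  by (simp add: path_image_polygonal_path_Cons del: polygonal_path.simps(4) subset_empty;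
      intro Un_Int_subset; rule segment_off_arrowhead; simp; linarith)+

lemma in_big_arrowhead:
  "z \<in> big_arrowhead \<longleftrightarrow> Re z - 7 \<le> 2 * Im z \<and> Im z - 7 \<le> 2 * Re z \<and> (Re z \<le> 3 \<or> Im z \<le> 3)"
  by (auto simp: big_arrowhead_def arrowhead_def)

text \<open>\<open>big_arrowhead\<close> is not convex because of its reflex corner, but it is the
  union of two convex parts, cut out by \<open>Re z \<le> 3\<close> and by
  \<open>Im z \<le> 3\<close>. A segment with both ends in one part stays there.\<close>

lemma segment_subset_big_arrowhead:
  assumes "Re p - 7 \<le> 2 * Im p" "Im p - 7 \<le> 2 * Re p" "Re q - 7 \<le> 2 * Im q" "Im q - 7 \<le> 2 * Re q"
    and "Re p \<le> 3 \<and> Re q \<le> 3 \<or> Im p \<le> 3 \<and> Im q \<le> 3"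
  shows "closed_segment p q \<subseteq> big_arrowhead"
proof -
  have half: "convex {z. x * Re z + y * Im z \<le> c}" for x y c :: real
    using convex_halfspace_le[of "Complex x y" c] by (simp add: inner_complex_def)
  define A where "A = {z. 1 * Re z + (-2) * Im z \<le> 7} \<inter> {z. (-2) * Re z + 1 * Im z \<le> 7}"
  have "convex A" unfolding A_def by (intro convex_Int half)
  note sub = convex_Int[OF this half[of 1 0 3], THEN closed_segment_subset[rotated 2], of p q]
    convex_Int[OF this half[of 0 1 3], THEN closed_segment_subset[rotated 2], of p q]
  have big: "A \<inter> {z. 1 * Re z + 0 * Im z \<le> 3} \<subseteq> big_arrowhead"
    "A \<inter> {z. 0 * Re z + 1 * Im z \<le> 3} \<subseteq> big_arrowhead"
    by (auto simp: A_def in_big_arrowhead)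
  from assms(5) show ?thesis
  proof
    assume "Re p \<le> 3 \<and> Re q \<le> 3"
    then have "closed_segment p q \<subseteq> A \<inter> {z. 1 * Re z + 0 * Im z \<le> 3}"
      using assms(1-4) by (intro sub(1)) (auto simp: A_def)
    then show ?thesis using big(1) by (rule subset_trans)
  next
    assume "Im p \<le> 3 \<and> Im q \<le> 3"
    then have "closed_segment p q \<subseteq> A \<inter> {z. 0 * Re z + 1 * Im z \<le> 3}"
      using assms(1-4) by (intro sub(2)) (auto simp: A_def)
    then show ?thesis using big(2) by (rule subset_trans)
  qed
qed

lemma gadget_subset_big_arrowhead:
  "path_image (polygonal_path edge1) \<subseteq> big_arrowhead" "path_image (polygonal_path edge2) \<subseteq> big_arrowhead"
  "path_image (polygonal_path loop1) \<subseteq> big_arrowhead" "path_image (polygonal_path loop2) \<subseteq> big_arrowhead"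
  "path_image (polygonal_path loop3) \<subseteq> big_arrowhead"
  unfolding gadget_defs
  by (simp add: path_image_polygonal_path_Cons del: polygonal_path.simps(4);
      (intro conjI)?; rule segment_subset_big_arrowhead; simp)+

lemma arrowhead_subset_big: "arrowhead \<subseteq> big_arrowhead"
  by (auto simp: arrowhead_def in_big_arrowhead)

lemma apex_notin_arrowhead: "apex \<notin> arrowhead" and zero_in_arrowhead: "0 \<in> arrowhead"
  by (simp_all add: arrowhead_def)

definition loops :: "(real \<Rightarrow> complex) set" where
  "loops = polygonal_path ` {loop1, loop2, loop3}"

definition gadget :: "(real \<Rightarrow> complex) set" where
  "gadget = polygonal_path ` {edge1, edge2, loop1, loop2, loop3}"

text \<open>The points at parameter 1/2 tell the curves apart. For lists of three or more points
  this is the second one, where the first join is made.\<close>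

lemma card_gadget: "card gadget = 5" and card_loops: "card loops = 3"
proof -
  let ?v = "\<lambda>g :: real \<Rightarrow> complex. g (1 / 2)"
  have v: "?v ` gadget = {apex / 2, Complex 2 1, Complex 13 3, Complex 2 6, Complex 2 0}"
    "?v ` loops = {Complex 13 3, Complex 2 6, Complex 2 0}"
    unfolding gadget_def loops_def image_image
    by (simp_all add: gadget_defs joinpaths_def linepath_def complex_eq_iff scaleR_conv_of_real)
  have "card gadget \<le> card {edge1, edge2, loop1, loop2, loop3}" "card loops \<le> card {loop1, loop2, loop3}"
    unfolding gadget_def loops_def by (intro card_image_le; simp)+
  moreover have "card {edge1, edge2, loop1, loop2, loop3} \<le> 5" "card {loop1, loop2, loop3} \<le> 3"
    by (auto simp: card_insert_if)
  moreover have "card (?v ` gadget) = 5" "card (?v ` loops) = 3"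
    unfolding v by (simp_all add: complex_eq_iff)
  moreover have "card (?v ` gadget) \<le> card gadget" "card (?v ` loops) \<le> card loops"
    by (intro card_image_le; simp add: gadget_def loops_def)+
  ultimately show "card gadget = 5" "card loops = 3" by linarith+
qed

lemma gadget_ends:
  "pathstart (polygonal_path edge1) = 0" "pathfinish (polygonal_path edge1) = apex"
  "pathstart (polygonal_path edge2) = 0" "pathfinish (polygonal_path edge2) = apex"
  "pathstart (polygonal_path loop1) = apex" "pathfinish (polygonal_path loop1) = apex"
  "pathstart (polygonal_path loop2) = apex" "pathfinish (polygonal_path loop2) = apex"
  "pathstart (polygonal_path loop3) = apex" "pathfinish (polygonal_path loop3) = apex"
  by (simp_all add: gadget_defs)

lemma gadget_length:
  "length edge1 \<ge> 2" "length edge2 \<ge> 2" "length loop1 \<ge> 2" "length loop2 \<ge> 2" "length loop3 \<ge> 2"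
  by (simp_all add: gadget_defs)

lemma gadget_disjoint:
  assumes "f \<in> gadget" "g \<in> gadget" "f \<noteq> g"
  shows "path_image f \<inter> path_image g \<subseteq> {0, apex}"
proof -
  define Q where "Q ps qs \<longleftrightarrow> path_image (polygonal_path ps) \<inter> path_image (polygonal_path qs) \<subseteq> {0, apex}"
    for ps qs
  have meet: "Q ps qs" "Q qs ps"
    if "lists_meet_in X ps qs" "length ps \<ge> 2" "length qs \<ge> 2" "X \<subseteq> {0, apex}" for X ps qs
    using subset_trans[OF lists_meet_in[OF that(1-3)] that(4)] by (simp_all only: Q_def Int_commute)
  note Q = gadget_lists_meet[THEN meet(1)] gadget_lists_meet[THEN meet(2)]
  obtain ps where ps: "ps \<in> {edge1, edge2, loop1, loop2, loop3}" "f = polygonal_path ps"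
    using assms(1) unfolding gadget_def by (rule imageE)
  obtain qs where qs: "qs \<in> {edge1, edge2, loop1, loop2, loop3}" "g = polygonal_path qs"
    using assms(2) unfolding gadget_def by (rule imageE)
  have "ps \<noteq> qs" using assms(3) ps qs by blast
  with ps(1) qs(1) have "Q ps qs"
    by (elim insertE emptyE) (simp_all add: Q gadget_length)
  then show ?thesis by (simp only: Q_def ps qs)
qed

lemma gadget_off_arrowhead:
  assumes "f \<in> gadget"
  shows "path_image f \<inter> arrowhead \<subseteq> {pathstart f, pathfinish f} \<inter> {0}"
  using assms edges_off_arrowhead loops_off_arrowhead
  unfolding gadget_def by (elim imageE insertE emptyE; simp add: gadget_ends)

lemma gadget_props:
  assumes "f \<in> gadget"
  shows "simple_path f" "pathstart f \<in> {0, apex}" "pathfinish f = apex"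
    "\<exists>ps. length ps \<ge> 2 \<and> f = polygonal_path ps \<and> ortho_fin ps" "path_image f \<subseteq> big_arrowhead"
proof -
  from assms obtain ps where ps: "ps \<in> {edge1, edge2, loop1, loop2, loop3}" "f = polygonal_path ps"
    by (auto simp: gadget_def)
  then show "simple_path f" "pathstart f \<in> {0, apex}" "pathfinish f = apex" "path_image f \<subseteq> big_arrowhead"
    using simple_gadget gadget_ends gadget_subset_big_arrowhead by auto
  have "length ps \<ge> 2" "ortho_fin ps" using ps(1) gadget_length ortho_fin_gadget by auto
  then show "\<exists>ps. length ps \<ge> 2 \<and> f = polygonal_path ps \<and> ortho_fin ps" using ps(2) by blast
qed

section \<open>Adding the gadget to a multigraph\<close>

lemma plane_ortho_fin_multigraphI:
  assumes "finite V"
    and "\<And>e. e \<in> E \<Longrightarrow> simple_path e" "\<And>e. e \<in> E \<Longrightarrow> pathstart e \<in> V" "\<And>e. e \<in> E \<Longrightarrow> pathfinish e \<in> V"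
    and "\<And>e. e \<in> E \<Longrightarrow> path_image e \<inter> V \<subseteq> {pathstart e, pathfinish e}"
    and "\<And>e. e \<in> E \<Longrightarrow> \<exists>ps. length ps \<ge> 2 \<and> e = polygonal_path ps \<and> ortho_fin ps"
    and "\<And>e f. e \<in> E \<Longrightarrow> f \<in> E \<Longrightarrow> e \<noteq> f \<Longrightarrow> path_image e \<inter> path_image f \<subseteq> V"
  shows "plane_ortho_fin_multigraph V E"
  unfolding plane_ortho_fin_multigraph_def plane_multigraph_def
  by (intro conjI ballI impI; rule assms)

lemma plane_ortho_fin_multigraphD:
  assumes "plane_ortho_fin_multigraph V E"
  shows "finite V"
    and "\<And>e. e \<in> E \<Longrightarrow> simple_path e" "\<And>e. e \<in> E \<Longrightarrow> pathstart e \<in> V" "\<And>e. e \<in> E \<Longrightarrow> pathfinish e \<in> V"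
    and "\<And>e. e \<in> E \<Longrightarrow> path_image e \<inter> V \<subseteq> {pathstart e, pathfinish e}"
    and "\<And>e. e \<in> E \<Longrightarrow> \<exists>ps. length ps \<ge> 2 \<and> e = polygonal_path ps \<and> ortho_fin ps"
    and "\<And>e f. e \<in> E \<Longrightarrow> f \<in> E \<Longrightarrow> e \<noteq> f \<Longrightarrow> path_image e \<inter> path_image f \<subseteq> V"
  using assms unfolding plane_ortho_fin_multigraph_def plane_multigraph_def by simp_all

lemma plane_ortho_fin_loops: "plane_ortho_fin_multigraph {apex} loops"
proof (rule plane_ortho_fin_multigraphI)
  have sub: "f \<in> gadget" if "f \<in> loops" for f using that by (auto simp: loops_def gadget_def)
  have start: "pathstart f = apex" if "f \<in> loops" for f
    using that gadget_ends by (auto simp: loops_def)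
  show "path_image f \<inter> path_image g \<subseteq> {apex}" if "f \<in> loops" "g \<in> loops" "f \<noteq> g" for f g
  proof -
    have "0 \<notin> path_image f"
      using that(1) loops_off_arrowhead zero_in_arrowhead by (auto simp: loops_def)
    then show ?thesis using gadget_disjoint[of f g] sub that by blast
  qed
  fix f assume f: "f \<in> loops"
  show "simple_path f" "\<exists>ps. length ps \<ge> 2 \<and> f = polygonal_path ps \<and> ortho_fin ps"
    by (rule gadget_props[OF sub[OF f]])+
  show "pathstart f \<in> {apex}" "pathfinish f \<in> {apex}" "path_image f \<inter> {apex} \<subseteq> {pathstart f, pathfinish f}"
    using start[OF f] gadget_props(3)[OF sub[OF f]] by auto
qed simp

lemma plane_ortho_fin_insert_gadget:
  assumes G: "plane_ortho_fin_multigraph V E"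
    and V: "0 \<in> V" "V \<subseteq> arrowhead" and inside: "\<And>e. e \<in> E \<Longrightarrow> path_image e \<subseteq> arrowhead"
  shows "plane_ortho_fin_multigraph (insert apex V) (gadget \<union> E)"
proof (rule plane_ortho_fin_multigraphI)
  note E = plane_ortho_fin_multigraphD[OF G]
  show "finite (insert apex V)" using E(1) by simp
  \<comment> \<open>Old edges stay inside the arrowhead, which a gadget curve meets at most in the
    old vertex 0.\<close>
  have mixed: "path_image e \<inter> path_image f \<subseteq> insert apex V" if "e \<in> gadget" "f \<in> E" for e f
  proof -
    have "path_image e \<inter> path_image f \<subseteq> path_image e \<inter> arrowhead"
      by (rule Int_mono[OF order_refl inside[OF that(2)]])
    also have "\<dots> \<subseteq> {pathstart e, pathfinish e} \<inter> {0}" by (rule gadget_off_arrowhead[OF that(1)])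
    also have "\<dots> \<subseteq> insert apex V" using V(1) by auto
    finally show ?thesis .
  qed
  show "path_image e \<inter> path_image f \<subseteq> insert apex V"
    if ef: "e \<in> gadget \<union> E" "f \<in> gadget \<union> E" "e \<noteq> f" for e f
    using ef(1)
  proof
    assume e: "e \<in> gadget"
    show ?thesis using ef(2)
    proof
      assume "f \<in> gadget"
      from gadget_disjoint[OF e this ef(3)] show ?thesis by (rule subset_trans) (simp add: V)
    qed (rule mixed[OF e])
  next
    assume e: "e \<in> E"
    show ?thesis using ef(2)
    proof
      assume "f \<in> gadget"
      from mixed[OF this e] show ?thesis by (simp only: Int_commute)
    next
      assume "f \<in> E"
      from E(7)[OF e this ef(3)] show ?thesis by (rule subset_trans) (rule subset_insertI)
    qed
  qed
  fix e assume "e \<in> gadget \<union> E"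
  then show "simple_path e" "pathstart e \<in> insert apex V" "pathfinish e \<in> insert apex V"
    "\<exists>ps. length ps \<ge> 2 \<and> e = polygonal_path ps \<and> ortho_fin ps"
    "path_image e \<inter> insert apex V \<subseteq> {pathstart e, pathfinish e}"
  proof (atomize(full), elim UnE, goal_cases)
    case 1
    then show ?case
      using gadget_props(1-4)[of e] gadget_off_arrowhead[of e] V by auto
  next
    case 2
    have "apex \<notin> path_image e" using inside[OF 2] apex_notin_arrowhead by blast
    then show ?case using E(2-6)[OF 2] by auto
  qed
qed

lemma polygonal_path_affine:
  assumes "\<And>z. f z = r *\<^sub>R z + d" "ps \<noteq> []"
  shows "polygonal_path (map f ps) = f \<circ> polygonal_path ps"
proof -
  \<comment> \<open>Edges are parametrised curves, so an equality of functions is required; it holds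
    because scaling and translation commute with \<open>linepath\<close>.\<close>
  have line: "linepath (f p) (f q) = f \<circ> linepath p q" for p q
    by (rule ext) (simp add: linepath_def assms(1) scaleR_conv_of_real algebra_simps)
  show ?thesis
    using assms(2) by (induction ps rule: polygonal_path.induct) (simp_all add: line path_compose_join)
qed

lemma ortho_fin_affine:
  assumes "\<And>z. f z = r *\<^sub>R z + d" "length ps \<ge> 2" "ortho_fin ps"
  shows "ortho_fin (map f ps)"
proof -
  have diff: "f x - f y = r *\<^sub>R (x - y)" for x y by (simp add: assms(1) scaleR_diff_right)
  have "parallel (r *\<^sub>R x) (r *\<^sub>R y)" if "parallel x y" for x y
    using that by (auto simp: parallel_def collinear_lemma)
  moreover have "orthogonal (r *\<^sub>R x) (r *\<^sub>R y)" if "orthogonal x y" for x y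
    using that by (simp add: orthogonal_def)
  moreover have "0 < length ps" "1 < length ps" using assms(2) by linarith+
  ultimately show ?thesis
    using assms(3) by (auto simp: ortho_fin_def Let_def diff simp del: length_greater_0_conv)
qed

lemma plane_ortho_fin_multigraph_affine:
  assumes f: "\<And>z. f z = r *\<^sub>R z + d" and "r \<noteq> 0" and G: "plane_ortho_fin_multigraph V E"
  shows "plane_ortho_fin_multigraph (f ` V) ((\<circ>) f ` E)"
proof -
  have inj: "inj f" using assms(2) by (auto simp: inj_def f)
  have cont: "continuous_on A f" for A
    by (simp add: f[abs_def] continuous_intros)
  note E = plane_ortho_fin_multigraphD[OF G]
  show ?thesis
  proof (rule plane_ortho_fin_multigraphI)
    show "finite (f ` V)" using E(1) by simp
    fix e' assume "e' \<in> (\<circ>) f ` E"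
    then obtain e where e: "e \<in> E" and e': "e' = f \<circ> e" by (rule imageE)
    show "simple_path e'"
      unfolding e' by (intro simple_path_continuous_image E(2)[OF e] cont inj_on_subset[OF inj]) simp
    show "pathstart e' \<in> f ` V" "pathfinish e' \<in> f ` V"
      using E(3,4)[OF e] by (simp_all add: e' pathstart_compose pathfinish_compose)
    have "path_image e' \<inter> f ` V = f ` (path_image e \<inter> V)"
      using inj by (simp add: e' path_image_compose image_Int)
    also have "\<dots> \<subseteq> f ` {pathstart e, pathfinish e}" by (rule image_mono[OF E(5)[OF e]])
    finally show "path_image e' \<inter> f ` V \<subseteq> {pathstart e', pathfinish e'}"
      by (simp add: e' pathstart_compose pathfinish_compose)
    obtain ps where ps: "length ps \<ge> 2" "e = polygonal_path ps" "ortho_fin ps" using E(6)[OF e] by blast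
    then have "ps \<noteq> []" by auto
    then have "e' = polygonal_path (map f ps)"
      using polygonal_path_affine[OF f, of ps] ps by (simp add: e')
    then show "\<exists>ps. length ps \<ge> 2 \<and> e' = polygonal_path ps \<and> ortho_fin ps"
      using ortho_fin_affine[OF f ps(1,3)] ps(1) by (intro exI[of _ "map f ps"]) simp
    fix g' assume "g' \<in> (\<circ>) f ` E" and neq: "e' \<noteq> g'"
    then obtain g where g: "g \<in> E" and g': "g' = f \<circ> g" by (elim imageE)
    have "path_image e' \<inter> path_image g' = f ` (path_image e \<inter> path_image g)"
      using inj by (simp add: e' g' path_image_compose image_Int)
    also have "\<dots> \<subseteq> f ` V"
      using neq e' g' by (intro image_mono E(7)[OF e g]) auto
    finally show "path_image e' \<inter> path_image g' \<subseteq> f ` V" .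
  qed
qed

definition fits_in_arrowhead :: "complex set \<Rightarrow> (real \<Rightarrow> complex) set \<Rightarrow> bool" where
  "fits_in_arrowhead V E \<longleftrightarrow> plane_ortho_fin_multigraph V E \<and> finite E \<and> 0 \<in> V \<and> V \<subseteq> arrowhead \<and>
     (\<forall>e\<in>E. path_image e \<subseteq> arrowhead)"

text \<open>The map taking \<open>apex\<close> to 0 and \<open>big_arrowhead\<close> into
  \<open>arrowhead\<close> restores the invariant after a gadget has been added; being injective, it
  preserves both cardinalities.\<close>

lemma shrink_to_arrowhead:
  assumes "plane_ortho_fin_multigraph V E" "finite E" "apex \<in> V" "V \<subseteq> big_arrowhead"
    and "\<forall>e\<in>E. path_image e \<subseteq> big_arrowhead"
  shows "\<exists>V' E'. fits_in_arrowhead V' E' \<and> card V' = card V \<and> card E' = card E"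
proof -
  define f where "f z = (1 / 10) *\<^sub>R z + - (apex / 10)" for z
  have f': "f z = (z - apex) / 10" for z by (simp add: f_def diff_divide_distrib scaleR_conv_of_real)
  have inj: "inj f" by (auto simp: inj_def f')
  have big: "f ` big_arrowhead \<subseteq> arrowhead" by (auto simp: big_arrowhead_def f')
  have "fits_in_arrowhead (f ` V) ((\<circ>) f ` E)"
    unfolding fits_in_arrowhead_def
  proof (intro conjI ballI)
    show "plane_ortho_fin_multigraph (f ` V) ((\<circ>) f ` E)"
      by (rule plane_ortho_fin_multigraph_affine[OF f_def _ assms(1)]) simp
    show "0 \<in> f ` V" using assms(3) by (intro image_eqI[of _ _ apex]) (auto simp: f')
    show "f ` V \<subseteq> arrowhead" using assms(4) big by blast
    fix e assume "e \<in> (\<circ>) f ` E"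
    then obtain g where g: "g \<in> E" "e = f \<circ> g" by (rule imageE)
    then have "path_image e \<subseteq> f ` big_arrowhead" using assms(5) by (simp add: path_image_compose image_mono)
    then show "path_image e \<subseteq> arrowhead" using big by (rule subset_trans)
  qed (use assms(2) in simp)
  moreover have "card (f ` V) = card V" by (intro card_image inj_on_subset[OF inj]) simp
  moreover have "card ((\<circ>) f ` E) = card E"
    by (intro card_image inj_on_subset[OF fun.inj_map[OF inj]]) simp
  ultimately show ?thesis by blast
qed

text \<open>Three loops at the first vertex and five curves with each further one:
  \<open>5 * n + 3 = 5 * Suc n - 2\<close>.\<close>

lemma exists_extremal_in_arrowhead:
  "\<exists>V E. fits_in_arrowhead V E \<and> card V = Suc n \<and> card E = 5 * n + 3"
proof (induction n)
  case 0
  have "\<forall>e\<in>loops. path_image e \<subseteq> big_arrowhead"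
    using gadget_subset_big_arrowhead by (auto simp: loops_def)
  moreover have "apex \<in> big_arrowhead" by (simp add: in_big_arrowhead)
  moreover have "finite loops" by (simp add: loops_def)
  ultimately show ?case
    using shrink_to_arrowhead[OF plane_ortho_fin_loops] card_loops by simp
next
  case (Suc n)
  then obtain V E where VE: "fits_in_arrowhead V E" "card V = Suc n" "card E = 5 * n + 3" by blast
  then have G: "plane_ortho_fin_multigraph V E" and fin: "finite E" and 0: "0 \<in> V" and V: "V \<subseteq> arrowhead"
    and E: "\<And>e. e \<in> E \<Longrightarrow> path_image e \<subseteq> arrowhead"
    by (auto simp: fits_in_arrowhead_def)
  have finV: "finite V" using VE(2) by (simp add: card_ge_0_finite)
  \<comment> \<open>Every gadget curve ends in \<open>apex\<close>, outside the arrowhead, so all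
    five edges are new.\<close>
  have "gadget \<inter> E = {}"
  proof -
    have "apex \<in> path_image f" if "f \<in> gadget" for f
      using gadget_props(3)[OF that] pathfinish_in_path_image[of f] by simp
    then show ?thesis using E apex_notin_arrowhead by blast
  qed
  moreover have fg: "finite gadget" by (simp add: gadget_def)
  ultimately have "card (gadget \<union> E) = 5 * Suc n + 3"
    using fin card_gadget VE(3) by (simp add: card_Un_disjoint)
  moreover have "card (insert apex V) = Suc (Suc n)"
    using V apex_notin_arrowhead finV VE(2) by (subst card_insert_disjoint) auto
  moreover have "insert apex V \<subseteq> big_arrowhead"
    using V arrowhead_subset_big by (auto simp: in_big_arrowhead)
  moreover have "\<forall>e\<in>gadget \<union> E. path_image e \<subseteq> big_arrowhead"
    using E arrowhead_subset_big gadget_props(5) by blast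
  ultimately show ?case
    using shrink_to_arrowhead[OF plane_ortho_fin_insert_gadget[OF G 0 V E]] fin fg by simp
qed

theorem theorem2:
  fixes n :: nat
  assumes "n \<ge> 1"
  shows "(\<forall>V E. plane_ortho_fin_multigraph V E \<and> card V = n \<longrightarrow>
            finite E \<and> card E \<le> 5 * n - 2) \<and>
         (\<exists>V E. plane_ortho_fin_multigraph V E \<and> card V = n \<and>
            finite E \<and> card E = 5 * n - 2)"
proof (intro conjI allI impI)
  fix V E assume "plane_ortho_fin_multigraph V E \<and> card V = n"
  with assms plane_ortho_fin_multigraph_finite_card[of V E]
  show "finite E" "card E \<le> 5 * n - 2" by auto
next
  obtain m where "n = Suc m" using assms by (cases n) auto
  moreover obtain V E where "fits_in_arrowhead V E" "card V = Suc m" "card E = 5 * m + 3"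
    using exists_extremal_in_arrowhead by blast
  ultimately show "\<exists>V E. plane_ortho_fin_multigraph V E \<and> card V = n \<and> finite E \<and> card E = 5 * n - 2"
    by (intro exI[of _ V] exI[of _ E]) (simp add: fits_in_arrowhead_def)
qed

end
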